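(* Let $p>2$ be a prime, let $\rho:\mathbb Q^{{\rm cyc},p}\hookrightarrow\mathbb C_p$ be a field embedding and let $\theta\in\mathrm{Aut}((\mathbb Q/\mathbb Z)^{(p)})$. If $\theta\in\{\pm1\}$ one has $$Z_\rho\left(\tfrac ab,\beta\right)=Z_{\theta\circ\rho}\left(\tfrac ab,\beta\right)\qquad\forall\,\tfrac ab\in(\mathbb Q/\mathbb Z)^{(p)},\ \beta\in D_p$$ (as meromorphic functions of $\beta$). If $\theta\notin\{\pm1\}$ and $\beta=1-m=1-k\varphi(q)$ with $k>0$ an integer, then the functionals $Z_\rho(\cdot,\beta)$ and $Z_{\theta\circ\rho}(\cdot,\beta)$ on $(\mathbb Q/\mathbb Z)^{(p)}$ are distinct.
   Context: Here $p>2$, $q=p$ and $\varphi(q)=p-1$. $\mathbb C_p$ is the completion of an algebraic closure of $\mathbb Q_p$ with $|p|_p=p^{-1}$. $D_p=\{\beta\in\mathbb C_p\mid|\beta|_p<q\,p^{-1/(p-1)}\}$. $(\mathbb Q/\mathbb Z)^{(p)}$ is the group of fractions mod $1$ with denominator prime to $p$. $\mathbb Q^{{\rm cyc},p}$ is the field generated over $\mathbb Q$ by the roots of unity $\zeta_\gamma$, $\gamma\in(\mathbb Q/\mathbb Z)^{(p)}$ ($\zeta_\gamma\zeta_{\gamma'}=\zeta_{\gamma+\gamma'}$, $\zeta_\gamma$ of order the denominator of $\gamma$). For $\theta\in\mathrm{Aut}((\mathbb Q/\mathbb Z)^{(p)})$, $\theta\circ\rho$ denotes the embedding $\rho'$ with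 $\rho'(\zeta_\gamma)=\rho(\zeta_{\theta(\gamma)})$. $\log_p$ is the Iwasawa logarithm, $\langle c\rangle^s=\exp(s\log_pc)$ for integers $c$ prime to $p$ and $s\in D_p$, and $B_j$ are the Bernoulli numbers, $\frac{t}{e^t-1}=\sum B_jt^j/j!$. For $b\ge1$ prime to $p$, $a\in\mathbb Z$, and any positive multiple $f$ of $bq$, $$Z_\rho\left(\tfrac ab,\beta\right)=\frac1f\sum_{1\le c<f,\ p\nmid c}\rho(\zeta_{a/b}^c)\,\frac{\langle c\rangle^{1-\beta}}{\beta-1}\sum_{j=0}^\infty\binom{1-\beta}{j}\left(\frac fc\right)^jB_j ;$$ this is a meromorphic function of $\beta\in D_p$, independent of the choice of $f$, whose only possible pole is $\beta=1$. *)

theory Defs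
  imports
    "HOL-Analysis.Analysis"
    "HOL-Computational_Algebra.Computational_Algebra"
    "HOL-Algebra.Group"
begin

section \<open>The field \<open>\<complex>\<^sub>p\<close>\<close>

text \<open>
  The absolute value is encoded by the metric of the type, \<open>\<bar>x\<bar> = dist x 0\<close>, so that the topological
  notions of the library (limits, series, closure) refer to it.  The sort alone imposes no
  compatibility of metric and field structure.
\<close>

definition vabs :: "'a::{field_char_0, complete_space} \<Rightarrow> real" where
  "vabs x = dist x 0"

text \<open>\<open>\<rat>\<^sub>p\<close> is the completion of \<open>\<rat>\<close>: in a complete field this is the closure of \<open>\<rat>\<close>.\<close>

definition Qp :: "'a::{field_char_0, complete_space} set" where
  "Qp = closure (range of_rat)"

definition Qp_alg :: "'a::{field_char_0, complete_space} set" where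
  "Qp_alg = {x. \<exists>P. P \<noteq> 0 \<and> (\<forall>i. coeff P i \<in> Qp) \<and> poly P x = 0}"

text \<open>
  The type \<open>'a\<close> with its absolute value is (a model of) the completion of an algebraic closure
  of \<open>\<rat>\<^sub>p\<close>, normalised by \<open>\<bar>p\<bar> = 1/p\<close>: it is a complete non-archimedean valued field in which the
  set of all elements algebraic over \<open>\<rat>\<^sub>p\<close> is algebraically closed and dense.  For prime \<open>p\<close> these
  properties force the absolute value on \<open>\<rat>\<close> to be the \<open>p\<close>-adic one and determine the
  valued field up to isometric isomorphism.
\<close>

definition is_Cp :: "nat \<Rightarrow> 'a::{field_char_0, complete_space} itself \<Rightarrow> bool" where
  "is_Cp p T \<longleftrightarrow>
     (\<forall>x y :: 'a. dist x y = vabs (x - y)) \<and>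
     (\<forall>x y :: 'a. vabs (x * y) = vabs x * vabs y) \<and>
     (\<forall>x y :: 'a. vabs (x + y) \<le> max (vabs x) (vabs y)) \<and>
     vabs (of_nat p :: 'a) = 1 / real p \<and>
     (\<forall>P :: 'a poly. degree P > 0 \<and> (\<forall>i. coeff P i \<in> Qp_alg) \<longrightarrow> (\<exists>x\<in>Qp_alg. poly P x = 0)) \<and>
     closure (Qp_alg :: 'a set) = UNIV"

text \<open>\<open>D\<^sub>p\<close>, with \<open>q = p\<close> (as \<open>p > 2\<close>).\<close>

definition Dp :: "nat \<Rightarrow> 'a::{field_char_0, complete_space} set" where
  "Dp p = {\<beta>. vabs \<beta> < real p * real p powr (- 1 / (real p - 1))}"

section \<open>Logarithm, exponential and Bernoulli numbers\<close>

definition Cp_exp :: "'a::{field_char_0, complete_space} \<Rightarrow> 'a" where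
  "Cp_exp x = (\<Sum>n. x ^ n / of_nat (fact n))"

definition Cp_log1 :: "'a::{field_char_0, complete_space} \<Rightarrow> 'a" where
  "Cp_log1 u = (\<Sum>n. (- 1) ^ n * (u - 1) ^ Suc n / of_nat (Suc n))"

text \<open>
  The Iwasawa logarithm is the homomorphism \<open>\<complex>\<^sub>p\<^sup>\<times> \<rightarrow> \<complex>\<^sub>p\<close> that is given by the power series on
  \<open>\<bar>u - 1\<bar> < 1\<close> and vanishes at \<open>p\<close>.  Every \<open>x \<noteq> 0\<close> has a power of the form \<open>x\<^sup>n = p\<^sup>k u\<close> with
  \<open>n > 0\<close> and \<open>\<bar>u - 1\<bar> < 1\<close>, so that its value at \<open>x\<close> is \<open>log u / n\<close>, for any such \<open>n, k, u\<close>.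
\<close>

definition iwasawa_log :: "nat \<Rightarrow> 'a::{field_char_0, complete_space} \<Rightarrow> 'a" where
  "iwasawa_log p x =
     (THE l. \<exists>(n::nat) (k::int) u. n > 0 \<and> vabs (u - 1) < 1 \<and>
               x ^ n = of_nat p powi k * u \<and> l = Cp_log1 u / of_nat n)"

definition angle_pow :: "nat \<Rightarrow> nat \<Rightarrow> 'a::{field_char_0, complete_space} \<Rightarrow> 'a" where
  "angle_pow p c s = Cp_exp (s * iwasawa_log p (of_nat c))"

definition bernoulli :: "nat \<Rightarrow> rat" where
  "bernoulli j = fact j * fps_nth (fps_X / (fps_exp 1 - 1)) j"

section \<open>The group \<open>(\<rat>/\<int>)\<^sup>(\<^sup>p\<^sup>)\<close> and the field \<open>\<rat>\<^sup>c\<^sup>y\<^sup>c\<^sup>,\<^sup>p\<close>\<close>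

definition denom :: "rat \<Rightarrow> nat" where
  "denom x = nat (snd (quotient_of x))"

text \<open>Classes modulo \<open>1\<close> are represented by their representatives in \<open>[0,1)\<close>.\<close>

definition QZ :: "nat \<Rightarrow> rat monoid" where
  "QZ p = \<lparr>carrier = {x. 0 \<le> x \<and> x < 1 \<and> coprime (denom x) p},
           mult = (\<lambda>x y. frac (x + y)), one = 0\<rparr>"

text \<open>\<open>\<theta> \<in> {\<plusminus>1}\<close> as an automorphism of \<^term>\<open>QZ p\<close>; \<open>inv\<close> is negation modulo \<open>1\<close>.\<close>

definition is_pm_one :: "nat \<Rightarrow> (rat \<Rightarrow> rat) \<Rightarrow> bool" where
  "is_pm_one p \<theta> \<longleftrightarrow>
     (\<forall>\<gamma>\<in>carrier (QZ p). \<theta> \<gamma> = \<gamma>) \<or> (\<forall>\<gamma>\<in>carrier (QZ p). \<theta> \<gamma> = inv\<^bsub>QZ p\<^esub> \<gamma>)"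

text \<open>A compatible system of roots of unity; the last clause says that \<open>\<zeta> \<gamma>\<close> has multiplicative
  order \<open>denom \<gamma>\<close>.\<close>

definition is_zeta_system :: "nat \<Rightarrow> (rat \<Rightarrow> 'b::field_char_0) \<Rightarrow> bool" where
  "is_zeta_system p \<zeta> \<longleftrightarrow>
     (\<forall>\<gamma>\<in>carrier (QZ p). \<forall>\<gamma>'\<in>carrier (QZ p). \<zeta> \<gamma> * \<zeta> \<gamma>' = \<zeta> (\<gamma> \<otimes>\<^bsub>QZ p\<^esub> \<gamma>')) \<and>
     (\<forall>\<gamma>\<in>carrier (QZ p). \<forall>n. \<zeta> \<gamma> ^ n = 1 \<longleftrightarrow> denom \<gamma> dvd n)"

definition is_subfield :: "'b::field set \<Rightarrow> bool" where
  "is_subfield F \<longleftrightarrow> 0 \<in> F \<and> 1 \<in> F \<and>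
     (\<forall>x\<in>F. \<forall>y\<in>F. x + y \<in> F \<and> x * y \<in> F) \<and> (\<forall>x\<in>F. - x \<in> F \<and> inverse x \<in> F)"

definition Qcyc :: "nat \<Rightarrow> (rat \<Rightarrow> 'b::field_char_0) \<Rightarrow> 'b set" where
  "Qcyc p \<zeta> = is_subfield hull (\<zeta> ` carrier (QZ p))"

definition field_embedding_on :: "'b::field set \<Rightarrow> ('b \<Rightarrow> 'a::field) \<Rightarrow> bool" where
  "field_embedding_on F \<rho> \<longleftrightarrow> \<rho> 1 = 1 \<and>
     (\<forall>x\<in>F. \<forall>y\<in>F. \<rho> (x + y) = \<rho> x + \<rho> y \<and> \<rho> (x * y) = \<rho> x * \<rho> y)"

text \<open>\<open>\<rho>'\<close> is the embedding \<open>\<theta> \<circ> \<rho>\<close>; the conditions determine it on \<open>\<rat>\<^sup>c\<^sup>y\<^sup>c\<^sup>,\<^sup>p\<close>.\<close>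

definition is_twist ::
    "nat \<Rightarrow> (rat \<Rightarrow> 'b::field_char_0) \<Rightarrow> (rat \<Rightarrow> rat) \<Rightarrow> ('b \<Rightarrow> 'a::field) \<Rightarrow> ('b \<Rightarrow> 'a) \<Rightarrow> bool" where
  "is_twist p \<zeta> \<theta> \<rho> \<rho>' \<longleftrightarrow>
     field_embedding_on (Qcyc p \<zeta>) \<rho>' \<and> (\<forall>\<gamma>\<in>carrier (QZ p). \<rho>' (\<zeta> \<gamma>) = \<rho> (\<zeta> (\<theta> \<gamma>)))"

section \<open>The functions \<open>Z\<^sub>\<rho>\<close>\<close>

text \<open>
  The defining formula, which makes sense for \<open>\<beta> \<in> D\<^sub>p\<close> with \<open>\<beta> \<noteq> 1\<close>.  The modulus \<open>f\<close> is an
  argument: any positive multiple of \<open>denom \<gamma> * p\<close> gives the same function.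
\<close>

definition Z_formula ::
    "nat \<Rightarrow> (rat \<Rightarrow> 'b::field_char_0) \<Rightarrow> ('b \<Rightarrow> 'a::{field_char_0, complete_space})
       \<Rightarrow> nat \<Rightarrow> rat \<Rightarrow> 'a \<Rightarrow> 'a" where
  "Z_formula p \<zeta> \<rho> f \<gamma> \<beta> =
     1 / of_nat f * (\<Sum>c | 1 \<le> c \<and> c < f \<and> \<not> p dvd c.
        \<rho> (\<zeta> \<gamma> ^ c) * (angle_pow p c (1 - \<beta>) / (\<beta> - 1)) *
        (\<Sum>j. ((1 - \<beta>) gchoose j) * (of_nat f / of_nat c) ^ j * of_rat (bernoulli j)))"

text \<open>
  The value at \<open>\<beta> \<in> D\<^sub>p\<close> of the meromorphic function given by this formula, where \<^const>\<open>None\<close>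
  stands for a pole.  At \<open>\<beta> = 1\<close> the value is the limit of the formula if it exists
  (removable singularity).
\<close>

definition Z ::
    "nat \<Rightarrow> (rat \<Rightarrow> 'b::field_char_0) \<Rightarrow> ('b \<Rightarrow> 'a::{field_char_0, complete_space})
       \<Rightarrow> nat \<Rightarrow> rat \<Rightarrow> 'a \<Rightarrow> 'a option" where
  "Z p \<zeta> \<rho> f \<gamma> \<beta> =
     (if \<beta> \<noteq> 1 then Some (Z_formula p \<zeta> \<rho> f \<gamma> \<beta>)
      else if \<exists>l. (Z_formula p \<zeta> \<rho> f \<gamma> \<longlongrightarrow> l) (at 1)
        then Some (Lim (at 1) (Z_formula p \<zeta> \<rho> f \<gamma>))
      else None)"

end

theory Submission
  imports Defs "HOL-Number_Theory.Residues"
begin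

text \<open>
  Write \<open>s = 1 - \<beta>\<close> and \<open>y = -f/c\<close>. Since \<open>\<langle>f - c\<rangle>\<^sup>s = \<langle>c\<rangle>\<^sup>s (1 + y)\<^sup>s\<close>, expanding the powers \<open>(1 + y)\<^sup>s\<^sup>-\<^sup>j\<close> and
  using \<open>\<Sum>\<^sub>j binom(n,j) B\<^sub>j = (-1)\<^sup>n B\<^sub>n\<close> shows that the coefficient of \<open>\<zeta>\<^sup>c\<close> in the formula for \<open>Z\<^sub>\<rho>\<close> is
  invariant under \<open>c \<mapsto> f - c\<close>. As \<open>\<zeta>\<^sup>f = 1\<close>, it follows that \<open>Z\<^sub>\<rho>\<close> does not change when \<open>\<zeta>\<close> is inverted.

  For \<open>\<beta> = 1 - m\<close> with \<open>p - 1\<close> dividing \<open>m\<close> one has \<open>\<langle>c\<rangle>\<^sup>m = c\<^sup>m\<close>, so the formula is the sum over \<open>c\<close> prime to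
  \<open>p\<close> of \<open>\<zeta>\<^sup>c B\<^sub>m(c/f)\<close>, up to a factor. By the distribution relation it equals
  \<open>-(H(\<zeta>) - p\<^sup>m\<^sup>-\<^sup>1 H(\<zeta>\<^sup>p)) / m\<close>, where \<open>H(\<zeta>) = N\<^sup>m\<^sup>-\<^sup>1 \<Sum>\<^sub>c \<zeta>\<^sup>c B\<^sub>m(c/N)\<close> for any \<open>N\<close> with \<open>\<zeta>\<^sup>N = 1\<close>. If the functionals
  of \<open>\<rho>\<close> and of its twist agree, then so do the functions \<open>H\<close>, and inverting the Fourier transform on
  \<open>\<int>/N\<close> gives \<open>B\<^sub>m(a/N) = B\<^sub>m(1/N)\<close> for \<open>\<theta>(1/N) = a/N\<close>. The even Bernoulli polynomial \<open>B\<^sub>m\<close> is injective on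
  \<open>[0,1/2]\<close> and symmetric about \<open>1/2\<close>, whence \<open>\<theta>(1/N) = \<plusminus>1/N\<close>.
\<close>

unbundle no vec_syntax

section \<open>Bernoulli polynomials\<close>

text \<open>The exponential generating function \<open>t/(e^t - 1)\<close> of the Bernoulli numbers.
  Giving it by rational coefficients lets identities proved over the rationals pass to every field
  of characteristic 0.\<close>

definition bern_fps :: "'a::field_char_0 fps" where
  "bern_fps = Abs_fps (\<lambda>n. of_rat (bernoulli n) / fact n)"

text \<open>Generic in the field: the character sums live in \<open>'a\<close>, the monotonicity
  argument in the reals, and rational arguments connect the two.\<close>

definition bern_poly :: "nat \<Rightarrow> 'a::field_char_0 \<Rightarrow> 'a" where
  "bern_poly m x = (\<Sum>k\<le>m. of_nat (m choose k) * of_rat (bernoulli k) * x ^ (m - k))"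

lemma of_rat_fact: "of_rat (fact n) = (fact n :: 'a::field_char_0)"
  by (metis of_nat_fact of_rat_of_nat_eq)

lemma fps_exp_minus_one_nonzero: "fps_exp c - 1 \<noteq> (0 :: 'a::field_char_0 fps)" if "c \<noteq> 0"
  using that arg_cong[of "fps_exp c - 1" 0 "\<lambda>F. F $ 1"] by auto

text \<open>Over the rationals the quotient defining \<open>bernoulli\<close> is exact, since
  \<open>fps_exp 1 - 1\<close> has subdegree 1. All coefficients being rational, the identity moves
  along \<open>of_rat\<close>.\<close>

lemma bern_fps_mult: "bern_fps * (fps_exp 1 - 1) = (fps_X :: 'a::field_char_0 fps)"
proof -
  have sd: "subdegree (fps_exp 1 - 1 :: rat fps) = 1"
    by (rule subdegreeI) (simp_all add: less_Suc0)
  have "(fps_exp 1 - 1 :: rat fps) dvd fps_X"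
    using sd by (subst fps_dvd_iff) (simp_all add: fps_exp_minus_one_nonzero del: subdegree_minus_commute)
  hence "fps_X div (fps_exp 1 - 1) * (fps_exp 1 - 1 :: rat fps) = fps_X"
    by simp
  moreover have "fps_X div (fps_exp 1 - 1) = (bern_fps :: rat fps)"
    by (rule fps_ext) (simp add: bern_fps_def bernoulli_def)
  ultimately have rat: "bern_fps * (fps_exp 1 - 1) = (fps_X :: rat fps)"
    by simp
  show ?thesis
  proof (rule fps_ext)
    fix n
    have b: "(bern_fps :: 'a fps) $ k = of_rat (bern_fps $ k)" for k
      by (simp add: bern_fps_def of_rat_divide of_rat_fact)
    have e: "(fps_exp 1 - 1 :: 'a fps) $ k = of_rat ((fps_exp 1 - 1) $ k)" for k
      by (cases k) (simp_all add: of_rat_divide of_rat_fact del: fact_Suc)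
    have "(bern_fps * (fps_exp 1 - 1) :: 'a fps) $ n = of_rat ((bern_fps * (fps_exp 1 - 1)) $ n)"
      by (simp only: fps_mult_nth b e of_rat_sum of_rat_mult)
    also have "\<dots> = fps_X $ n"
      by (simp add: rat)
    finally show "(bern_fps * (fps_exp 1 - 1) :: 'a fps) $ n = fps_X $ n" .
  qed
qed

text \<open>The classical generating function \<open>t e^(xt)/(e^t - 1)\<close>; reflection and
  distribution are read off from its coefficients.\<close>

lemma fps_nth_bern_fps_exp: "(bern_fps * fps_exp x) $ m = bern_poly m x / fact m"
proof -
  have "(bern_fps * fps_exp x) $ m
      = (\<Sum>k\<le>m. of_rat (bernoulli k) / fact k * (x ^ (m - k) / fact (m - k)))"
    by (simp add: fps_mult_nth bern_fps_def atLeast0AtMost)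
  also have "\<dots> = bern_poly m x / fact m"
    unfolding bern_poly_def sum_divide_distrib
    by (intro sum.cong refl) (simp add: binomial_fact)
  finally show ?thesis .
qed

lemma bern_poly_0_right [simp]: "bern_poly m 0 = of_rat (bernoulli m)"
proof -
  have "bern_poly m 0 = (\<Sum>k\<in>{m}. of_nat (m choose k) * of_rat (bernoulli k) * (0::'a) ^ (m - k))"
    unfolding bern_poly_def by (intro sum.mono_neutral_right) auto
  thus ?thesis by simp
qed

lemma bern_poly_one: "bern_poly m 1 = of_rat (bernoulli m) + (if m = 1 then 1 else (0::'a::field_char_0))"
proof -
  have "bern_fps * fps_exp 1 = fps_X + (bern_fps :: 'a fps)"
    using bern_fps_mult[where 'a='a] by (simp add: algebra_simps)
  from arg_cong[OF this, of "\<lambda>F. F $ m"]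
  have "bern_poly m 1 / fact m = (if m = 1 then 1 else 0) + of_rat (bernoulli m) / (fact m :: 'a)"
    by (simp add: fps_nth_bern_fps_exp) (simp add: bern_fps_def)
  thus ?thesis by (auto simp: field_simps split: if_splits)
qed

text \<open>Substituting \<open>-t\<close> for \<open>t\<close> turns \<open>t/(e^t - 1)\<close>
  into \<open>t e^t/(e^t - 1)\<close>, so the series for \<open>1 - x\<close> is the series for
  \<open>x\<close> at \<open>-t\<close>.\<close>

lemma bern_poly_reflect: "bern_poly m (1 - x) = (-1) ^ m * bern_poly m (x :: 'a::field_char_0)"
proof -
  let ?N = "- fps_X :: 'a fps"
  have "(bern_fps oo ?N) * (fps_exp (-1) - 1) = ?N"
  proof -
    have "(bern_fps oo ?N) * (fps_exp (-1) - 1) = (bern_fps * (fps_exp 1 - 1)) oo ?N"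
      by (subst fps_compose_mult_distrib) (simp_all add: fps_compose_sub_distrib)
    thus ?thesis by (simp add: bern_fps_mult)
  qed
  hence "(bern_fps oo ?N) * ((fps_exp (-1) - 1) * fps_exp 1) = ?N * fps_exp 1"
    by (metis mult.assoc)
  moreover have "(fps_exp (-1) - 1) * fps_exp 1 = - (fps_exp 1 - 1 :: 'a fps)"
    by (simp add: algebra_simps flip: fps_exp_add_mult)
  ultimately have "- ((bern_fps oo ?N) * (fps_exp 1 - 1)) = - (fps_X * fps_exp 1)"
    by (simp only: mult_minus_left mult_minus_right)
  hence "(bern_fps oo ?N) * (fps_exp 1 - 1) = fps_X * fps_exp 1"
    by (simp only: neg_equal_iff_equal)
  also have "\<dots> = (bern_fps * fps_exp 1) * (fps_exp 1 - 1)"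
    by (simp add: bern_fps_mult[symmetric] mult_ac)
  finally have "bern_fps oo ?N = bern_fps * fps_exp 1"
    using fps_exp_minus_one_nonzero[of "1::'a"] by simp
  hence "bern_fps * fps_exp (1 - x) = (bern_fps * fps_exp x) oo ?N"
    using fps_exp_add_mult[of 1 "-x"]
    by (simp add: fps_compose_mult_distrib mult.assoc)
  also have "\<dots> = Abs_fps (\<lambda>n. (-1) ^ n * (bern_fps * fps_exp x) $ n)"
    by (rule fps_compose_uminus')
  finally have "(bern_fps * fps_exp (1 - x)) $ m = (-1) ^ m * (bern_fps * fps_exp x) $ m"
    by simp
  thus ?thesis by (simp add: fps_nth_bern_fps_exp)
qed

lemma sum_binomial_bernoulli:
  "(\<Sum>k\<le>n. of_nat (n choose k) * of_rat (bernoulli k)) = (-1) ^ n * (of_rat (bernoulli n) :: 'a::field_char_0)"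
  using bern_poly_reflect[of n "0::'a"] by (simp add: bern_poly_def[of n 1])

lemma bernoulli_odd_eq_0: "bernoulli n = 0" if "odd n" "n \<noteq> 1"
  using bern_poly_reflect[of n "0::rat"] that by (simp add: bern_poly_one)

lemma sum_fps_exp_mult:
  "(\<Sum>k<n. fps_exp (of_nat k * c)) * (fps_exp c - 1) = fps_exp (of_nat n * c) - (1 :: 'a::field_char_0 fps)"
proof -
  have "fps_exp (of_nat k * c) = fps_exp c ^ k" for k
    by (simp add: fps_exp_power_mult)
  thus ?thesis
    using power_diff_1_eq[of "fps_exp c" n] by (simp add: mult.commute)
qed

text \<open>The factors \<open>e^(kt/n)\<close> form a geometric sum; multiplied by
  \<open>t/(e^t - 1)\<close> it becomes \<open>n\<close> times the same series at
  \<open>t/n\<close>. The power \<open>n ^ m\<close> stands on the left so that no exponent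
  \<open>1 - m\<close> occurs.\<close>

lemma bern_poly_distribution:
  fixes x :: "'a::field_char_0"
  assumes "n > 0"
  shows "of_nat n ^ m * (\<Sum>k<n. bern_poly m (x + of_nat k / of_nat n)) = of_nat n * bern_poly m (of_nat n * x)"
proof -
  define c where "c = (1 / of_nat n :: 'a)"
  have nc: "of_nat n * c = 1" "c \<noteq> 0" using assms by (auto simp: c_def)
  let ?L = "fps_const c * fps_X"
  have L: "(bern_fps oo ?L) * (fps_exp c - 1) = ?L"
  proof -
    have "(bern_fps oo ?L) * (fps_exp c - 1) = (bern_fps * (fps_exp 1 - 1)) oo ?L"
      by (subst fps_compose_mult_distrib) (simp_all add: fps_compose_sub_distrib)
    thus ?thesis by (simp add: bern_fps_mult)
  qed
  have "(bern_fps * (\<Sum>k<n. fps_exp (of_nat k * c))) * (fps_exp c - 1) = fps_X"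
    using sum_fps_exp_mult[of c n] by (simp add: mult.assoc nc bern_fps_mult)
  also have "\<dots> = (fps_const (of_nat n) * (bern_fps oo ?L)) * (fps_exp c - 1)"
    by (simp only: mult.assoc L) (simp flip: mult.assoc add: nc fps_const_mult)
  finally have eq: "bern_fps * (\<Sum>k<n. fps_exp (of_nat k * c)) = fps_const (of_nat n) * (bern_fps oo ?L)"
    using fps_exp_minus_one_nonzero[OF nc(2)] by simp
  have "(\<Sum>k<n. bern_fps * fps_exp (x + of_nat k * c)) = (bern_fps * (\<Sum>k<n. fps_exp (of_nat k * c))) * fps_exp x"
    by (simp add: fps_exp_add_mult sum_distrib_left sum_distrib_right mult_ac)
  also have "\<dots> = fps_const (of_nat n) * ((bern_fps oo ?L) * fps_exp x)"
    by (simp add: eq mult.assoc)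
  also have "(bern_fps oo ?L) * fps_exp x = (bern_fps * fps_exp (of_nat n * x)) oo ?L"
    by (simp add: fps_compose_mult_distrib c_def assms[THEN less_imp_neq, symmetric])
  finally have "(\<Sum>k<n. bern_fps * fps_exp (x + of_nat k * c)) $ m
      = of_nat n * (c ^ m * (bern_fps * fps_exp (of_nat n * x)) $ m)"
    by simp
  hence "(\<Sum>k<n. bern_poly m (x + of_nat k * c)) = of_nat n * c ^ m * bern_poly m (of_nat n * x)"
    by (simp add: fps_sum_nth fps_nth_bern_fps_exp field_simps flip: sum_divide_distrib)
  thus ?thesis using assms
    by (simp add: c_def field_simps)
qed

text \<open>Faulhaber's formula, from the expansion of \<open>(e^(nt) - 1)/(e^t - 1)\<close>. The
  indexing makes the term \<open>k = 0\<close> equal to \<open>n B_m\<close>, which isolates the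
  newest Bernoulli number in \<open>vabs_bernoulli_le\<close>.\<close>

lemma bernoulli_power_sum:
  "(\<Sum>k\<le>m. of_nat (m choose k) * of_rat (bernoulli (m - k)) * (of_nat n ^ Suc k / of_nat (Suc k)))
     = (\<Sum>a<n. of_nat a ^ m :: 'a::field_char_0)"
proof -
  have "bern_fps * (fps_exp (of_nat n) - 1) = (bern_fps * (fps_exp 1 - 1)) * (\<Sum>k<n. fps_exp (of_nat k :: 'a))"
    using sum_fps_exp_mult[of "1::'a" n] by (simp add: mult_ac)
  hence eq: "(fps_exp (of_nat n) - 1) * bern_fps = fps_X * (\<Sum>k<n. fps_exp (of_nat k :: 'a))"
    by (simp add: bern_fps_mult mult.commute)
  have "(\<Sum>k\<le>m. (of_nat n ^ Suc k / fact (Suc k)) * (of_rat (bernoulli (m - k)) / fact (m - k) :: 'a))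
      = ((fps_exp (of_nat n) - 1) * bern_fps) $ Suc m"
    unfolding fps_mult_nth atLeast0AtMost sum.atMost_Suc_shift[of _ m]
    by (simp add: bern_fps_def del: fact_Suc power_Suc)
  also have "\<dots> = (\<Sum>a<n. of_nat a ^ m / fact m)"
    by (simp add: eq fps_sum_nth)
  finally have "fact m * (\<Sum>k\<le>m. (of_nat n ^ Suc k / fact (Suc k)) * (of_rat (bernoulli (m - k)) / fact (m - k) :: 'a))
      = (\<Sum>a<n. of_nat a ^ m)"
    by (simp flip: sum_divide_distrib)
  moreover have "fact m * ((of_nat n ^ Suc k / fact (Suc k)) * (of_rat (bernoulli (m - k)) / fact (m - k) :: 'a))
      = of_nat (m choose k) * of_rat (bernoulli (m - k)) * (of_nat n ^ Suc k / of_nat (Suc k))" if "k \<le> m" for k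
    using that by (simp add: binomial_fact mult_ac)
  ultimately show ?thesis
    by (simp add: sum_distrib_left)
qed

lemma of_rat_bern_poly: "of_rat (bern_poly m x) = bern_poly m (of_rat x)"
  by (simp add: bern_poly_def of_rat_sum of_rat_mult of_rat_power)

section \<open>Even Bernoulli polynomials on the real unit interval\<close>

lemma has_field_derivative_bern_poly:
  "(bern_poly (Suc m) has_real_derivative (real (Suc m) * bern_poly m x)) (at x within S)"
proof -
  have "(bern_poly (Suc m) has_real_derivative
      (\<Sum>k\<le>Suc m. real (Suc m choose k) * of_rat (bernoulli k) * (real (Suc m - k) * x ^ (Suc m - k - 1)))) (at x within S)"
    unfolding bern_poly_def[abs_def] by (auto intro!: derivative_eq_intros simp: mult_ac)
  also have "(\<Sum>k\<le>Suc m. real (Suc m choose k) * of_rat (bernoulli k) * (real (Suc m - k) * x ^ (Suc m - k - 1)))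
      = (\<Sum>k\<le>m. real (Suc m choose k) * of_rat (bernoulli k) * (real (Suc m - k) * x ^ (Suc m - k - 1)))"
    by simp
  also have "\<dots> = real (Suc m) * bern_poly m x"
    unfolding bern_poly_def sum_distrib_left
  proof (intro sum.cong refl)
    fix k assume "k \<in> {..m}"
    have "(Suc m choose k) * (Suc m - k) = Suc m * (m choose k)"
      using binomial_absorb_comp[of "Suc m" k] by (simp add: mult.commute)
    hence "real (Suc m choose k) * real (Suc m - k) = real (Suc m) * real (m choose k)"
      by (metis of_nat_mult)
    thus "real (Suc m choose k) * of_rat (bernoulli k) * (real (Suc m - k) * x ^ (Suc m - k - 1)) =
        real (Suc m) * (real (m choose k) * of_rat (bernoulli k) * x ^ (m - k))"
      by (simp del: of_nat_Suc of_nat_diff add: mult_ac)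
  qed
  finally show ?thesis .
qed

lemma bern_poly_Rolle:
  fixes u v :: real
  assumes "u < v" "bern_poly (Suc m) u = bern_poly (Suc m) v"
  obtains w where "u < w" "w < v" "bern_poly m w = 0"
proof -
  have "\<exists>w>u. w < v \<and> (\<lambda>h. real (Suc m) * bern_poly m w * h) = (\<lambda>h. 0)"
  proof (rule Rolle_deriv[OF assms])
    show "continuous_on {u..v} (bern_poly (Suc m))"
      by (rule DERIV_continuous_on[OF has_field_derivative_bern_poly])
    show "(bern_poly (Suc m) has_derivative (\<lambda>h. real (Suc m) * bern_poly m x * h)) (at x)" for x :: real
      using has_field_derivative_bern_poly[of m x UNIV] by (rule has_field_derivative_imp_has_derivative)
  qed
  then obtain w where "u < w" "w < v" "(\<lambda>h. real (Suc m) * bern_poly m w * h) = (\<lambda>h. 0)" by blast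
  from this(1,2) fun_cong[OF this(3), of 1] show ?thesis by (intro that[of w]) auto
qed

lemma linordered_inj_onI:
  fixes g :: "'a::linorder \<Rightarrow> 'b"
  assumes "\<And>u v. u < v \<Longrightarrow> u \<in> A \<Longrightarrow> v \<in> A \<Longrightarrow> g u \<noteq> g v"
  shows "inj_on g A"
proof (rule inj_onI)
  fix u v assume "u \<in> A" "v \<in> A" "g u = g v"
  thus "u = v" using assms[of u v] assms[of v u] by (cases u v rule: linorder_cases) simp_all
qed

text \<open>Equal values at two points give, by Rolle, a zero in \<open>(0,1/2)\<close> of the odd derivative. That also
  vanishes at \<open>0\<close> and \<open>1/2\<close>, so the even polynomial below it has two zeros in \<open>(0,1/2)\<close>.\<close>
lemma bern_poly_even_inj: "inj_on (bern_poly (2 * Suc k) :: real \<Rightarrow> real) {0..1/2}"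
proof (induction k)
  case 0
  have neq: False if uv: "0 \<le> u" "u < v" "v \<le> 1/2" "bern_poly (2 * Suc 0) u = bern_poly (2 * Suc 0) v" for u v :: real
  proof -
    from uv(4) have "bern_poly (Suc 1) u = bern_poly (Suc 1) v"
      by (simp add: numeral_2_eq_2)
    from bern_poly_Rolle[OF uv(2) this]
    obtain w where w: "u < w" "w < v" "bern_poly 1 w = 0" by metis
    \<comment> \<open>The power sum formula with \<open>m = 0\<close> and \<open>n = 1\<close>
      consists of this one term.\<close>
    have "bernoulli 0 = 1"
      using bernoulli_power_sum[of 0 1, where 'a=rat] by simp
    hence "bern_poly 1 w = w + bern_poly 1 0"
      by (simp add: bern_poly_def)
    \<comment> \<open>The two expressions for the value at 1 force
      \<open>bern_poly 1 0 = -1/2\<close>. The only zero of \<open>bern_poly 1\<close> is therefore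
      \<open>1/2\<close>, whereas \<open>w < v \<le> 1/2\<close>.\<close>
    moreover have "bern_poly 1 (1::real) = 1 + bern_poly 1 0"
      by (simp add: bern_poly_one)
    moreover have "bern_poly 1 (1::real) = - bern_poly 1 0"
      using bern_poly_reflect[of 1 "0::real"] by simp
    ultimately show False using w uv by simp
  qed
  hence "bern_poly (2 * Suc 0) u \<noteq> bern_poly (2 * Suc 0) v"
    if "u < v" "u \<in> {0..1/2}" "v \<in> {0..1/2}" for u v :: real
    using that neq[of u v] by auto
  thus ?case by (rule linordered_inj_onI)
next
  case (Suc k)
  let ?n = "2 * Suc k"
  have half: "bern_poly (Suc ?n) (1/2) = (0::real)"
    using bern_poly_reflect[of "Suc ?n" "1/2::real"] by simp
  have zero: "bern_poly (Suc ?n) 0 = (0::real)"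
    by (simp add: bernoulli_odd_eq_0)
  have neq: False if uv: "0 \<le> u" "u < v" "v \<le> 1/2" "bern_poly (2 * Suc (Suc k)) u = bern_poly (2 * Suc (Suc k)) v" for u v :: real
  proof -
    from uv(4) have "bern_poly (Suc (Suc ?n)) u = bern_poly (Suc (Suc ?n)) v"
      by simp
    from bern_poly_Rolle[OF uv(2) this]
    obtain w where w: "u < w" "w < v" "bern_poly (Suc ?n) w = 0" by metis
    have "0 < w" "bern_poly (Suc ?n) 0 = bern_poly (Suc ?n) w"
      using w uv(1) zero by simp_all
    from bern_poly_Rolle[OF this]
    obtain w1 where w1: "0 < w1" "w1 < w" "bern_poly ?n w1 = 0" by metis
    have "w < 1/2" "bern_poly (Suc ?n) w = bern_poly (Suc ?n) (1/2)"
      using w uv(3) half by simp_all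
    from bern_poly_Rolle[OF this]
    obtain w2 where w2: "w < w2" "w2 < 1/2" "bern_poly ?n w2 = 0" by metis
    have "w1 \<in> {0..1/2}" "w2 \<in> {0..1/2}"
      using w w1 w2 uv by auto
    hence "w1 = w2"
      using w1(3) w2(3) inj_onD[OF Suc] by metis
    thus False using w1 w2 by simp
  qed
  hence "bern_poly (2 * Suc (Suc k)) u \<noteq> bern_poly (2 * Suc (Suc k)) v"
    if "u < v" "u \<in> {0..1/2}" "v \<in> {0..1/2}" for u v :: real
    using that neq[of u v] by auto
  thus ?case by (rule linordered_inj_onI)
qed

lemma bern_poly_even_eqD:
  fixes u v :: real
  assumes "even m" "m > 0" "u \<in> {0..1}" "v \<in> {0..1}" "bern_poly m u = bern_poly m v"
  shows "u = v \<or> u = 1 - v"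
proof -
  have m: "m = 2 * Suc k" if "k = m div 2 - 1" for k
    using assms(1,2) that by (cases "m = 0") (auto elim!: evenE)
  define k where "k = m div 2 - 1"
  note m = m[OF k_def]
  \<comment> \<open>\<open>h\<close> folds \<open>[0,1]\<close> onto \<open>[0,1/2]\<close> along
    the symmetry about \<open>1/2\<close>; on the half interval injectivity is known.\<close>
  define h where "h x = (if x \<le> 1/2 then x else 1 - x)" for x :: real
  have "bern_poly m (h x) = bern_poly m x" for x
    using assms(1) by (simp add: h_def bern_poly_reflect)
  hence "bern_poly (2 * Suc k) (h u) = bern_poly (2 * Suc k) (h v)"
    using assms(5) unfolding m by simp
  moreover have "h u \<in> {0..1/2}" "h v \<in> {0..1/2}"
    using assms(3,4) by (auto simp: h_def)
  ultimately have "h u = h v"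
    by (rule inj_onD[OF bern_poly_even_inj])
  thus ?thesis by (auto simp: h_def split: if_splits)
qed

section \<open>Series over complete ultrametric fields\<close>

text \<open>These three laws are the whole link between metric and arithmetic, so the limit rules
  for sums and multiples are derived from them.\<close>

locale ultrametric_field =
  fixes ty :: "'a::{field_char_0, complete_space} itself"
  assumes dist_eq_vabs: "dist x y = vabs (x - y :: 'a)"
    and vabs_mult: "vabs (x * y :: 'a) = vabs x * vabs y"
    and vabs_add_le: "vabs (x + y :: 'a) \<le> max (vabs x) (vabs y)"
begin

lemma vabs_zero [simp]: "vabs (0 :: 'a) = 0"
  by (simp add: vabs_def)

lemma vabs_nonneg [simp]: "0 \<le> vabs (x :: 'a)"
  by (simp add: vabs_def)

lemma vabs_eq_0_iff [simp]: "vabs x = 0 \<longleftrightarrow> x = (0 :: 'a)"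
  by (simp add: vabs_def)

lemma vabs_pos_iff [simp]: "0 < vabs x \<longleftrightarrow> x \<noteq> (0 :: 'a)"
  by (simp add: vabs_def)

lemma vabs_one [simp]: "vabs (1 :: 'a) = 1"
proof -
  have "vabs (1 :: 'a) * vabs (1 :: 'a) = vabs (1 :: 'a) * 1"
    using vabs_mult[of 1 1] by simp
  thus ?thesis using mult_left_cancel[of "vabs (1 :: 'a)" "vabs (1 :: 'a)" 1] by simp
qed

lemma vabs_minus [simp]: "vabs (- x) = vabs (x :: 'a)"
  using dist_eq_vabs[of 0 x] dist_eq_vabs[of x 0] by (simp add: dist_commute)

lemma vabs_minus_commute: "vabs (x - y) = vabs (y - x :: 'a)"
  using vabs_minus[of "x - y"] by simp

lemma vabs_diff_le: "vabs (x - y :: 'a) \<le> max (vabs x) (vabs y)"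
  using vabs_add_le[of x "- y"] by simp

lemma vabs_power: "vabs (x ^ n :: 'a) = vabs x ^ n"
  by (induction n) (simp_all add: vabs_mult)

lemma vabs_divide: "vabs (x / y :: 'a) = vabs x / vabs y"
proof (cases "y = 0")
  case False
  hence "vabs (x / y) * vabs y = vabs x" by (simp flip: vabs_mult)
  thus ?thesis using False by (simp add: field_simps)
qed simp

lemma vabs_sum_le:
  assumes "\<And>i. i \<in> A \<Longrightarrow> vabs (g i :: 'a) \<le> B" "0 \<le> B"
  shows "vabs (sum g A) \<le> B"
  using assms
proof (induction A rule: infinite_finite_induct)
  case (insert i A)
  have "vabs (g i + sum g A) \<le> max (vabs (g i)) (vabs (sum g A))" by (rule vabs_add_le)
  also have "\<dots> \<le> B" using insert by simp
  finally show ?case using insert by simp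
qed simp_all

lemma vabs_prod: "vabs (prod g A :: 'a) = (\<Prod>i\<in>A. vabs (g i))"
  by (induction A rule: infinite_finite_induct) (simp_all add: vabs_mult)

lemma vabs_of_nat_le_1: "vabs (of_nat n :: 'a) \<le> 1"
proof (induction n)
  case (Suc n)
  have "vabs (1 + of_nat n :: 'a) \<le> max (vabs (1::'a)) (vabs (of_nat n :: 'a))" by (rule vabs_add_le)
  thus ?case using Suc by simp
qed simp

text \<open>Otherwise \<open>x = (x + y) - y\<close> would be a difference of two elements that are
  both smaller than \<open>x\<close>.\<close>

lemma vabs_add_eq_left: "vabs (x + y :: 'a) = vabs x" if "vabs y < vabs x"
proof -
  have "vabs (x + y - y) \<le> max (vabs (x + y)) (vabs y)" by (rule vabs_diff_le)
  hence "vabs x \<le> vabs (x + y)" using that by simp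
  moreover have "vabs (x + y) \<le> vabs x" using vabs_add_le[of x y] that by simp
  ultimately show ?thesis by simp
qed

section \<open>Null sequences and convergence of series\<close>

lemma LIMSEQ_iff_vabs: "(X \<longlonglongrightarrow> (l :: 'a)) \<longleftrightarrow> (\<forall>e>0. \<exists>N. \<forall>n\<ge>N. vabs (X n - l) < e)"
  by (simp add: lim_sequentially dist_eq_vabs)

abbreviation null :: "(nat \<Rightarrow> 'a) \<Rightarrow> bool" where
  "null g \<equiv> g \<longlonglongrightarrow> 0"

lemma null_iff: "null g \<longleftrightarrow> (\<forall>e>0. \<exists>N. \<forall>n\<ge>N. vabs (g n) < e)"
  by (simp add: LIMSEQ_iff_vabs)

lemma null_iff_vabs: "null g \<longleftrightarrow> (\<lambda>n. vabs (g n)) \<longlonglongrightarrow> 0"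
  by (simp add: null_iff lim_sequentially vabs_def[abs_def])

lemma null_dominated: "null g" if "h \<longlonglongrightarrow> 0" "\<And>n. vabs (g n) \<le> h n"
  unfolding null_iff_vabs
  by (rule real_tendsto_sandwich[OF _ _ tendsto_const that(1)]) (simp_all add: that(2))

lemma null_bounded:
  assumes "null g"
  obtains B where "B > 0" "\<And>n. vabs (g n) \<le> B"
proof -
  have "Bseq (\<lambda>n. vabs (g n))"
    using assms convergentI convergent_imp_Bseq by (auto simp: null_iff_vabs)
  then obtain B where "B > 0" "\<And>n. norm (vabs (g n)) \<le> B" by (auto simp: Bseq_def)
  thus ?thesis by (intro that[of B]) auto
qed

lemma limit_vabs_le: "vabs (l :: 'a) \<le> B" if "X \<longlonglongrightarrow> l" "\<And>n. n \<ge> N \<Longrightarrow> vabs (X n) \<le> B"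
proof -
  have "(\<lambda>n. vabs (X n)) \<longlonglongrightarrow> vabs l"
    unfolding vabs_def by (intro tendsto_dist that tendsto_const)
  thus ?thesis by (rule LIMSEQ_le_const2) (use that in auto)
qed

lemma LIMSEQ_add_vabs: "(\<lambda>n. X n + Y n) \<longlonglongrightarrow> k + (l :: 'a)" if "X \<longlonglongrightarrow> k" "Y \<longlonglongrightarrow> l"
  unfolding LIMSEQ_iff_vabs
proof (intro allI impI)
  fix e :: real assume "e > 0"
  with that obtain M N where MN: "\<And>n. n \<ge> M \<Longrightarrow> vabs (X n - k) < e" "\<And>n. n \<ge> N \<Longrightarrow> vabs (Y n - l) < e"
    unfolding LIMSEQ_iff_vabs by metis
  have "vabs (X n + Y n - (k + l)) < e" if "n \<ge> max M N" for n
  proof -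
    have "X n + Y n - (k + l) = (X n - k) + (Y n - l)" by simp
    hence "vabs (X n + Y n - (k + l)) \<le> max (vabs (X n - k)) (vabs (Y n - l))"
      by (metis vabs_add_le)
    thus ?thesis using MN[of n] that by simp
  qed
  thus "\<exists>N. \<forall>n\<ge>N. vabs (X n + Y n - (k + l)) < e" by blast
qed

lemma LIMSEQ_mult_vabs: "(\<lambda>n. c * X n) \<longlonglongrightarrow> c * (l :: 'a)" if "X \<longlonglongrightarrow> l"
proof (cases "c = 0")
  case False
  have "(\<lambda>n. vabs c * vabs (X n - l)) \<longlonglongrightarrow> vabs c * 0"
    using tendsto_dist_iff[THEN iffD1, OF that] by (intro tendsto_mult tendsto_const) (simp only: dist_eq_vabs)
  thus ?thesis
    unfolding tendsto_dist_iff[of "\<lambda>n. c * X n"] dist_eq_vabs right_diff_distrib[symmetric] vabs_mult by simp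
qed simp

text \<open>A block of consecutive terms is bounded by its largest term, so null terms already make
  the partial sums a Cauchy sequence.\<close>

lemma summable_null: "summable g" if g: "null g"
proof -
  have "Cauchy (\<lambda>n. \<Sum>i<n. g i)"
  proof (rule metric_CauchyI)
    fix e :: real assume "e > 0"
    then obtain N where N: "\<And>n. n \<ge> N \<Longrightarrow> vabs (g n) < e / 2"
      using g half_gt_zero[of e] unfolding null_iff by metis
    have *: "dist (\<Sum>i<m. g i) (\<Sum>i<n. g i) < e" if "N \<le> m" "m \<le> n" for m n
    proof -
      have "(\<Sum>i<n. g i) - (\<Sum>i<m. g i) = (\<Sum>i\<in>{m..<n}. g i)"
        using that sum_diff[of "{..<n}" "{..<m}" g] by (simp add: lessThan_minus_lessThan)
      moreover have "vabs (\<Sum>i\<in>{m..<n}. g i) \<le> e / 2"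
        using N that \<open>e > 0\<close> by (intro vabs_sum_le) (auto intro!: less_imp_le)
      ultimately show ?thesis using \<open>e > 0\<close>
        by (simp add: dist_eq_vabs vabs_minus_commute[of "sum g {..<m}"])
    qed
    have "dist (\<Sum>i<m. g i) (\<Sum>i<n. g i) < e" if "N \<le> m" "N \<le> n" for m n
      using *[of m n] *[of n m] that by (cases "m \<le> n") (simp_all add: dist_commute)
    thus "\<exists>M. \<forall>m\<ge>M. \<forall>n\<ge>M. dist (\<Sum>i<m. g i) (\<Sum>i<n. g i) < e" by blast
  qed
  hence "convergent (\<lambda>n. \<Sum>i<n. g i)" by (rule Cauchy_convergent)
  thus ?thesis by (simp add: summable_iff_convergent)
qed

lemma summable_LIMSEQ_sum: "(\<lambda>n. \<Sum>i<n. g i) \<longlonglongrightarrow> suminf g" if "summable g" for g :: "nat \<Rightarrow> 'a"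
  using summable_sums[OF that] by (simp add: sums_def)

lemma suminf_tail_le:
  assumes "null g" "\<And>i. i \<ge> N \<Longrightarrow> vabs (g i) \<le> B" "0 \<le> B"
  shows "vabs (suminf g - (\<Sum>i<N. g i)) \<le> B"
proof (rule limit_vabs_le[where N = N])
  show "(\<lambda>n. (\<Sum>i<n. g i) - (\<Sum>i<N. g i)) \<longlonglongrightarrow> suminf g - (\<Sum>i<N. g i)"
    using LIMSEQ_add_vabs[OF summable_LIMSEQ_sum[OF summable_null[OF assms(1)]] tendsto_const[of "- (\<Sum>i<N. g i)"]]
    by simp
  fix n assume "n \<ge> N"
  have "(\<Sum>i<n. g i) - (\<Sum>i<N. g i) = (\<Sum>i\<in>{N..<n}. g i)"
    using sum_diff[of "{..<n}" "{..<N}" g] \<open>n \<ge> N\<close> by (simp add: lessThan_minus_lessThan)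
  moreover have "vabs (\<Sum>i\<in>{N..<n}. g i) \<le> B"
    using assms by (intro vabs_sum_le) auto
  ultimately show "vabs ((\<Sum>i<n. g i) - (\<Sum>i<N. g i)) \<le> B" by simp
qed

lemma vabs_suminf_le: "vabs (suminf g) \<le> B" if "null g" "\<And>i. vabs (g i) \<le> B"
  using suminf_tail_le[of g 0 B] that order_trans[OF vabs_nonneg that(2)[of 0]] by simp

lemma suminf_mult_vabs: "(\<Sum>n. c * g n) = c * suminf g" if "null g"
proof -
  have "(\<lambda>n. \<Sum>i<n. c * g i) \<longlonglongrightarrow> c * suminf g"
    unfolding sum_distrib_left[symmetric]
    by (intro LIMSEQ_mult_vabs summable_LIMSEQ_sum summable_null that)
  thus ?thesis by (simp add: sums_def sums_unique[symmetric])
qed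

text \<open>Padding a row with \<open>i\<close> leading zeros; this is how
  \<open>suminf_diagonal\<close> recovers row sums from a triangular array.\<close>

lemma suminf_shift: "(\<Sum>n. if i \<le> n then g (n - i) else 0) = suminf g" if "null g"
proof -
  let ?h = "\<lambda>n. if i \<le> n then g (n - i) else 0"
  have "(\<Sum>k<n + i. ?h k) = (\<Sum>k<n. g k)" for n
  proof -
    have "(\<Sum>k<n + i. ?h k) = (\<Sum>k\<in>{i..<n + i}. g (k - i))"
      by (intro sum.mono_neutral_cong_right) auto
    also have "\<dots> = (\<Sum>k<n. g k)"
      by (intro sum.reindex_bij_witness[of _ "\<lambda>k. k + i" "\<lambda>k. k - i"]) auto
    finally show ?thesis .
  qed
  hence "(\<lambda>n. \<Sum>k<n + i. ?h k) \<longlonglongrightarrow> suminf g"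
    using summable_LIMSEQ_sum[OF summable_null[OF that]] by simp
  hence "(\<lambda>n. \<Sum>k<n. ?h k) \<longlonglongrightarrow> suminf g" by (rule LIMSEQ_offset)
  thus ?thesis by (simp add: sums_def sums_unique[symmetric])
qed

text \<open>Smallness outside a finite square, in both indices at once. It takes the place of
  absolute convergence in exchanging and regrouping double series.\<close>

definition null2 :: "(nat \<Rightarrow> nat \<Rightarrow> 'a) \<Rightarrow> bool" where
  "null2 a \<longleftrightarrow> (\<forall>e>0. \<exists>N. \<forall>i j. N \<le> i \<or> N \<le> j \<longrightarrow> vabs (a i j) < e)"

lemma null2_row: "null2 a \<Longrightarrow> null (a i)"
  unfolding null2_def null_iff by meson

lemma null2_transpose: "null2 a \<Longrightarrow> null2 (\<lambda>i j. a j i)"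
  unfolding null2_def by meson

lemma null2_suminf: "null (\<lambda>i. suminf (a i))" if "null2 a"
  unfolding null_iff
proof (intro allI impI)
  fix e :: real assume "e > 0"
  with that obtain N where N: "\<And>i j. N \<le> i \<or> N \<le> j \<Longrightarrow> vabs (a i j) < e / 2"
    unfolding null2_def by (meson half_gt_zero)
  have "vabs (suminf (a n)) \<le> e / 2" if "n \<ge> N" for n
    using N that by (intro vabs_suminf_le null2_row \<open>null2 a\<close> less_imp_le) blast
  thus "\<exists>N. \<forall>n\<ge>N. vabs (suminf (a n)) < e"
    using \<open>e > 0\<close> by (intro exI[of _ N]) fastforce
qed

text \<open>First the rows from \<open>N\<close> on are dropped, then the columns from
  \<open>N\<close> on in the remaining rows. Each cut costs at most \<open>e\<close>, and
  ultrametric errors do not add up.\<close>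

lemma null2_suminf_approx:
  assumes "null2 a" "\<And>i j. N \<le> i \<or> N \<le> j \<Longrightarrow> vabs (a i j) \<le> e" "e \<ge> 0"
  shows "vabs ((\<Sum>i. \<Sum>j. a i j) - (\<Sum>i<N. \<Sum>j<N. a i j)) \<le> e"
proof -
  have "vabs ((\<Sum>i. \<Sum>j. a i j) - (\<Sum>i<N. \<Sum>j. a i j)) \<le> e"
    using assms by (intro suminf_tail_le null2_suminf vabs_suminf_le null2_row) auto
  moreover have "vabs ((\<Sum>i<N. \<Sum>j. a i j) - (\<Sum>i<N. \<Sum>j<N. a i j)) \<le> e"
    unfolding sum_subtractf[symmetric]
    using assms by (intro vabs_sum_le suminf_tail_le null2_row) auto
  ultimately show ?thesis
    using vabs_add_le[of "(\<Sum>i. \<Sum>j. a i j) - (\<Sum>i<N. \<Sum>j. a i j)" "(\<Sum>i<N. \<Sum>j. a i j) - (\<Sum>i<N. \<Sum>j<N. a i j)"]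
    by simp
qed

text \<open>Both iterated sums lie within \<open>e\<close> of the same finite square sum, for every
  positive \<open>e\<close>.\<close>

lemma suminf_swap: "(\<Sum>i. \<Sum>j. a i j) = (\<Sum>j. \<Sum>i. a i j)" if "null2 a"
proof -
  have "vabs ((\<Sum>i. \<Sum>j. a i j) - (\<Sum>j. \<Sum>i. a i j)) \<le> e" if "e > 0" for e
  proof -
    from \<open>null2 a\<close> \<open>e > 0\<close> obtain N where N: "\<And>i j. N \<le> i \<or> N \<le> j \<Longrightarrow> vabs (a i j) < e"
      unfolding null2_def by meson
    have 1: "vabs ((\<Sum>i. \<Sum>j. a i j) - (\<Sum>i<N. \<Sum>j<N. a i j)) \<le> e"
      using N \<open>e > 0\<close> by (intro null2_suminf_approx \<open>null2 a\<close>) (auto intro: less_imp_le)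
    have 2: "vabs ((\<Sum>j. \<Sum>i. a i j) - (\<Sum>j<N. \<Sum>i<N. a i j)) \<le> e"
      using N \<open>e > 0\<close> by (intro null2_suminf_approx null2_transpose[OF \<open>null2 a\<close>]) (auto intro: less_imp_le)
    have "(\<Sum>i<N. \<Sum>j<N. a i j) = (\<Sum>j<N. \<Sum>i<N. a i j)" by (rule sum.swap)
    thus ?thesis
      using 1 2 vabs_diff_le[of "(\<Sum>i. \<Sum>j. a i j) - (\<Sum>i<N. \<Sum>j<N. a i j)" "(\<Sum>j. \<Sum>i. a i j) - (\<Sum>j<N. \<Sum>i<N. a i j)"]
      by simp
  qed
  hence "vabs ((\<Sum>i. \<Sum>j. a i j) - (\<Sum>j. \<Sum>i. a i j)) \<le> 0"
    using field_le_epsilon[of "vabs ((\<Sum>i. \<Sum>j. a i j) - (\<Sum>j. \<Sum>i. a i j))" 0] by (metis add_0)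
  hence "vabs ((\<Sum>i. \<Sum>j. a i j) - (\<Sum>j. \<Sum>i. a i j)) = 0"
    using vabs_nonneg antisym by metis
  thus ?thesis by simp
qed

lemma null2_diagonal: "null2 (\<lambda>n i. if i \<le> n then a i (n - i) else 0)" if "null2 a"
  unfolding null2_def
proof (intro allI impI)
  fix e :: real assume "e > 0"
  with that obtain N where N: "\<And>i j. N \<le> i \<or> N \<le> j \<Longrightarrow> vabs (a i j) < e"
    unfolding null2_def by meson
  \<comment> \<open>When \<open>i \<le> n\<close>, either alternative gives
    \<open>2 * N \<le> n\<close>; since \<open>i\<close> and \<open>n - i\<close> add up to
    \<open>n\<close>, one of them is then at least \<open>N\<close>.\<close>
  have "vabs (if i \<le> n then a i (n - i) else 0) < e" if "2 * N \<le> n \<or> 2 * N \<le> i" for n i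
  proof (cases "i \<le> n")
    case True
    hence "N \<le> i \<or> N \<le> n - i" using that by linarith
    thus ?thesis using N True by simp
  qed (simp add: \<open>e > 0\<close>)
  thus "\<exists>N. \<forall>n i. N \<le> n \<or> N \<le> i \<longrightarrow> vabs (if i \<le> n then a i (n - i) else 0) < e" by blast
qed

lemma suminf_diagonal_inner:
  "(\<Sum>i. if i \<le> n then a i (n - i) else 0) = (\<Sum>i\<le>n. a i (n - i) :: 'a)"
  by (subst suminf_finite[of "{..n}"]) auto

lemma suminf_diagonal: "(\<Sum>i. \<Sum>j. a i j) = (\<Sum>n. \<Sum>i\<le>n. a i (n - i))" if "null2 a"
proof -
  have "(\<Sum>n. \<Sum>i\<le>n. a i (n - i)) = (\<Sum>n. \<Sum>i. if i \<le> n then a i (n - i) else 0)"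
    by (simp only: suminf_diagonal_inner)
  also have "\<dots> = (\<Sum>i. \<Sum>n. if i \<le> n then a i (n - i) else 0)"
    by (rule suminf_swap[OF null2_diagonal[OF that]])
  also have "\<dots> = (\<Sum>i. \<Sum>j. a i j)"
    by (simp only: suminf_shift[OF null2_row[OF that]])
  finally show ?thesis ..
qed

lemma null_diagonal: "null (\<lambda>n. \<Sum>i\<le>n. a i (n - i))" if "null2 a"
  using null2_suminf[OF null2_diagonal[OF that]] by (simp only: suminf_diagonal_inner)

lemma null2_mult: "null2 (\<lambda>i j. g i * h j)" if g: "null g" and h: "null h"
  unfolding null2_def
proof (intro allI impI)
  fix e :: real assume "e > 0"
  obtain B where B: "B > 0" "\<And>n. vabs (g n) \<le> B" using null_bounded[OF g] by metis
  obtain C where C: "C > 0" "\<And>n. vabs (h n) \<le> C" using null_bounded[OF h] by metis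
  obtain M where M: "\<And>n. n \<ge> M \<Longrightarrow> vabs (g n) < e / C"
    using g \<open>e > 0\<close> C(1) unfolding null_iff by (meson divide_pos_pos)
  obtain N where N: "\<And>n. n \<ge> N \<Longrightarrow> vabs (h n) < e / B"
    using h \<open>e > 0\<close> B(1) unfolding null_iff by (meson divide_pos_pos)
  have "vabs (g i * h j) < e" if "max M N \<le> i \<or> max M N \<le> j" for i j
    using that
  proof
    assume "max M N \<le> i"
    hence "vabs (g i) * vabs (h j) \<le> vabs (g i) * C" "vabs (g i) * C < e"
      using M[of i] C(1) \<open>max M N \<le> i\<close> by (auto intro: mult_left_mono C(2) simp: pos_less_divide_eq)
    thus ?thesis by (simp only: vabs_mult)
  next
    assume "max M N \<le> j"
    hence "vabs (g i) * vabs (h j) \<le> B * vabs (h j)" "B * vabs (h j) < e"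
      using N[of j] B(1) \<open>max M N \<le> j\<close> by (auto intro: mult_right_mono B(2) simp: pos_less_divide_eq mult.commute)
    thus ?thesis by (simp only: vabs_mult)
  qed
  thus "\<exists>N. \<forall>i j. N \<le> i \<or> N \<le> j \<longrightarrow> vabs (g i * h j) < e" by blast
qed

subsection \<open>Evaluation of formal power series\<close>

text \<open>By \<open>summable_null\<close>, null terms are all that convergence at \<open>y\<close>
  requires.\<close>

definition fps_conv :: "'a fps \<Rightarrow> 'a \<Rightarrow> bool" where
  "fps_conv F y \<longleftrightarrow> null (\<lambda>n. fps_nth F n * y ^ n)"

definition fps_eval :: "'a fps \<Rightarrow> 'a \<Rightarrow> 'a" where
  "fps_eval F y = (\<Sum>n. fps_nth F n * y ^ n)"

lemma fps_mult_nth_power: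
  fixes F G :: "'a fps"
  shows
  "fps_nth (F * G) n * y ^ n = (\<Sum>i\<le>n. (fps_nth F i * y ^ i) * (fps_nth G (n - i) * y ^ (n - i)))"
proof -
  have *: "(fps_nth F i * y ^ i) * (fps_nth G (n - i) * y ^ (n - i)) = fps_nth F i * fps_nth G (n - i) * y ^ n"
    if "i \<le> n" for i
    using that power_add[of y i "n - i"] by (simp add: mult_ac)
  show ?thesis
    unfolding fps_mult_nth atLeast0AtMost sum_distrib_right
    by (intro sum.cong refl) (simp only: * atMost_iff)
qed

text \<open>The Cauchy product is the diagonal summation of the array of products of terms, so both
  claims are instances of the double series lemmas.\<close>

lemma fps_conv_mult: "fps_conv (F * G) y"
  and fps_eval_mult: "fps_eval (F * G) y = fps_eval F y * fps_eval G y"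
  if "fps_conv F y" "fps_conv G y"
proof -
  let ?F = "\<lambda>n. fps_nth F n * y ^ n" and ?G = "\<lambda>n. fps_nth G n * y ^ n"
  have FG: "null ?F" "null ?G" using that by (simp_all add: fps_conv_def)
  note n2 = null2_mult[OF FG]
  show "fps_conv (F * G) y"
    using null_diagonal[OF n2] by (simp only: fps_conv_def fps_mult_nth_power)
  have "fps_eval (F * G) y = (\<Sum>i. \<Sum>j. ?F i * ?G j)"
    by (simp only: fps_eval_def fps_mult_nth_power suminf_diagonal[OF n2])
  also have "\<dots> = (\<Sum>i. suminf ?G * ?F i)"
    by (simp only: suminf_mult_vabs[OF FG(2)] mult.commute)
  also have "\<dots> = suminf ?G * suminf ?F"
    by (rule suminf_mult_vabs[OF FG(1)])
  finally show "fps_eval (F * G) y = fps_eval F y * fps_eval G y"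
    by (simp add: fps_eval_def mult.commute)
qed

lemma fps_conv_one: "fps_conv 1 y" and fps_eval_one: "fps_eval 1 y = 1"
proof -
  show "fps_conv 1 y"
    unfolding fps_conv_def null_iff by (auto intro!: exI[of _ 1])
  have "fps_eval 1 y = (\<Sum>n\<in>{0}. fps_nth 1 n * y ^ n)"
    unfolding fps_eval_def by (intro suminf_finite) auto
  thus "fps_eval 1 y = 1" by simp
qed

lemma fps_conv_power: "fps_conv (F ^ k) y" if "fps_conv F y"
  by (induction k) (simp_all add: fps_conv_one fps_conv_mult that)

lemma fps_eval_power: "fps_eval (F ^ k) y = fps_eval F y ^ k" if "fps_conv F y"
  by (induction k) (simp_all add: fps_eval_one fps_eval_mult fps_conv_power that)

text \<open>The supremum of the terms at \<open>y\<close> is a Gauss norm, and such a norm is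
  submultiplicative.\<close>

lemma vabs_fps_power_nth_le:
  fixes F :: "'a fps"
  assumes "\<And>n. vabs (fps_nth F n * y ^ n) \<le> M"
  shows "vabs (fps_nth (F ^ k) n * y ^ n) \<le> M ^ k"
proof (induction k arbitrary: n)
  case 0
  show ?case by (cases n) simp_all
next
  case (Suc k)
  have "0 \<le> M" using assms[of 0] vabs_nonneg order_trans by blast
  thus ?case
    using assms Suc unfolding power_Suc fps_mult_nth_power
    by (intro vabs_sum_le) (auto simp: vabs_mult[of "_ * _" "_ * _"] intro!: mult_mono)
qed

text \<open>Expand \<open>G(F(y))\<close> into the double series with rows \<open>G_k F^k\<close>
  and exchange the sums. The decay is demanded for \<open>M\<close> and not just for the value of
  \<open>F\<close> at \<open>y\<close>, because the rows must become small uniformly in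
  \<open>n\<close>.\<close>

lemma fps_eval_compose:
  assumes F0: "fps_nth F 0 = 0" and conv: "fps_conv F y"
    and le: "\<And>n. vabs (fps_nth F n * y ^ n) \<le> M" and lim: "(\<lambda>k. vabs (fps_nth G k) * M ^ k) \<longlonglongrightarrow> 0"
  shows "fps_eval (G oo F) y = fps_eval G (fps_eval F y)"
proof -
  define a where "a k n = fps_nth G k * (fps_nth (F ^ k) n * y ^ n)" for k n
  have a_le: "vabs (a k n) \<le> vabs (fps_nth G k) * M ^ k" for k n
    unfolding a_def vabs_mult[of "fps_nth G k"]
    by (intro mult_left_mono vabs_fps_power_nth_le le) simp_all
  have row: "null (\<lambda>n. fps_nth (F ^ k) n * y ^ n)" for k
    using fps_conv_power[OF conv] by (simp add: fps_conv_def)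
  have "null2 a"
    unfolding null2_def
  proof (intro allI impI)
    fix e :: real assume "e > 0"
    with lim obtain K where K: "\<And>k. k \<ge> K \<Longrightarrow> norm (vabs (fps_nth G k) * M ^ k) < e"
      by (force simp: lim_sequentially)
    have "\<exists>N. \<forall>n\<ge>N. vabs (a k n) < e" for k
      using LIMSEQ_mult_vabs[OF row, of "fps_nth G k" k] \<open>e > 0\<close> by (simp add: a_def null_iff)
    then obtain N where N: "\<And>k n. n \<ge> N k \<Longrightarrow> vabs (a k n) < e" by metis
    \<comment> \<open>From \<open>K\<close> on the row bound is uniform; each of the finitely many
      earlier rows has its own threshold. Inserting \<open>0\<close> keeps the set nonempty when
      \<open>K = 0\<close>.\<close>
    define L where "L = max K (Max (insert 0 (N ` {..<K})))"
    have "vabs (a k n) < e" if "L \<le> k \<or> L \<le> n" for k n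
    proof (cases "k \<ge> K")
      case True
      thus ?thesis using K[of k] a_le[of k n] by simp
    next
      case False
      hence "N k \<le> L" by (auto simp: L_def intro!: le_max_iff_disj[THEN iffD2] Max_ge)
      thus ?thesis using N[where k=k] that False by (auto simp: L_def)
    qed
    thus "\<exists>L. \<forall>k n. L \<le> k \<or> L \<le> n \<longrightarrow> vabs (a k n) < e" by blast
  qed
  hence "(\<Sum>k. \<Sum>n. a k n) = (\<Sum>n. \<Sum>k. a k n)" by (rule suminf_swap)
  moreover have "(\<Sum>n. a k n) = fps_nth G k * fps_eval F y ^ k" for k
    unfolding a_def suminf_mult_vabs[OF row] by (simp only: fps_eval_def[of "_ ^ _", symmetric] fps_eval_power[OF conv])
  moreover have "(\<Sum>k. a k n) = fps_nth (G oo F) n * y ^ n" for n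
  proof -
    have "(\<Sum>k. a k n) = (\<Sum>k\<in>{0..n}. a k n)"
      using startsby_zero_power_prefix[OF F0] by (intro suminf_finite) (auto simp: a_def)
    thus ?thesis by (simp add: a_def fps_compose_nth sum_distrib_right mult.assoc)
  qed
  ultimately show ?thesis by (simp add: fps_eval_def)
qed

end

section \<open>The \<open>p\<close>-adic exponential and logarithm\<close>

text \<open>Both sides solve \<open>(1 + X) G' = s G\<close> with constant term 1.\<close>

lemma fps_exp_compose_ln:
  "fps_exp 1 oo (fps_const s * fps_ln 1) = fps_binomial (s :: 'a::field_char_0)"
proof -
  let ?G = "fps_exp 1 oo (fps_const s * fps_ln 1)"
  have "fps_deriv ?G = ?G * (fps_const s * inverse (1 + fps_X))"
    by (subst fps_compose_deriv) (simp_all add: fps_ln_deriv)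
  hence "fps_deriv ?G = fps_const s * ?G / (1 + fps_X)"
    by (simp add: fps_divide_unit mult_ac)
  thus ?thesis
    using fps_binomial_ODE_unique'[of ?G s] by simp
qed

lemma fps_binomial_add: "fps_binomial (a + b) = fps_binomial a * fps_binomial (b :: 'a::field_char_0)"
  by (rule fps_ext) (simp add: fps_mult_nth gbinomial_Vandermonde)

locale padic_field = ultrametric_field ty
  for ty :: "'a::{field_char_0, complete_space} itself" +
  fixes p :: nat
  assumes prime: "prime p" and p_gt_2: "p > 2"
    and vabs_p: "vabs (of_nat p :: 'a) = 1 / real p"
begin

section \<open>Absolute values of natural numbers and factorials\<close>

lemma odd_p: "odd p"
  using prime p_gt_2 prime_odd_nat by blast

lemma vabs_of_nat_dvd: "vabs (of_nat n :: 'a) \<le> 1 / real p" if "p dvd n"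
proof -
  from that obtain k where "n = p * k" by blast
  thus ?thesis
    using mult_left_mono[OF vabs_of_nat_le_1[of k], of "1 / real p"] by (simp add: vabs_mult vabs_p)
qed

lemma fermat_diff_dvd: "p dvd c ^ (p - 1) - 1" if "\<not> p dvd c"
  using fermat_theorem[OF prime that] that
  by (intro cong_to_1_nat) simp

text \<open>By Fermat \<open>n ^ (p - 1)\<close> is 1 plus a multiple of \<open>p\<close>, hence of
  absolute value 1; so is its root \<open>n\<close>.\<close>

lemma vabs_of_nat_coprime: "vabs (of_nat n :: 'a) = 1" if "\<not> p dvd n"
proof -
  have "n > 0" using that by (cases "n = 0") auto
  hence "of_nat (n ^ (p - 1)) = 1 + (of_nat (n ^ (p - 1) - 1) :: 'a)"
    by (simp add: of_nat_diff)
  moreover have "vabs (of_nat (n ^ (p - 1) - 1) :: 'a) < vabs (1 :: 'a)"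
    using vabs_of_nat_dvd[OF fermat_diff_dvd[OF that]] p_gt_2
    by (elim order.strict_trans1) simp
  ultimately have "vabs (of_nat n :: 'a) ^ (p - 1) = 1"
    by (metis vabs_add_eq_left vabs_one vabs_power of_nat_power)
  thus ?thesis
    using p_gt_2 power_eq_1_iff[of "vabs (of_nat n :: 'a)" "p - 1"] by simp
qed

lemma vabs_of_nat_less_1_iff: "vabs (of_nat n :: 'a) < 1 \<longleftrightarrow> p dvd n"
  using vabs_of_nat_coprime[of n] vabs_of_nat_dvd[of n] p_gt_2
  by (cases "p dvd n") (auto intro: order.strict_trans1)

text \<open>The radius of convergence of the exponential series; \<open>Dp p\<close> is the disc of
  radius \<open>p * exp_radius\<close>.\<close>

definition exp_radius :: real where "exp_radius = real p powr (- 1 / (real p - 1))"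

lemma exp_radius_pos: "0 < exp_radius"
  using p_gt_2 by (simp add: exp_radius_def)

lemma exp_radius_power: "exp_radius ^ (p - 1) = 1 / real p"
proof -
  have "exp_radius ^ (p - 1) = exp_radius powr (real p - 1)"
    using p_gt_2 exp_radius_pos by (subst powr_realpow[symmetric]) (simp_all add: of_nat_diff)
  also have "\<dots> = real p powr (-1)"
    using p_gt_2 unfolding exp_radius_def powr_powr by simp
  finally show ?thesis by (simp add: powr_minus_divide)
qed

lemma exp_radius_less_1: "exp_radius < 1"
  using p_gt_2 by (simp add: exp_radius_def powr_less_one divide_neg_pos)

lemma inverse_p_less_exp_radius: "1 / real p < exp_radius"
proof -
  have "exp_radius ^ (p - 1) < exp_radius ^ 1"
    using exp_radius_pos exp_radius_less_1 p_gt_2 by (intro power_strict_decreasing) auto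
  thus ?thesis by (simp only: exp_radius_power power_one_right)
qed

lemma inverse_p_power_le: "(1 / real p) ^ n \<le> exp_radius ^ n"
  using inverse_p_less_exp_radius p_gt_2 by (intro power_mono) auto

text \<open>One step of Legendre's formula: among \<open>1, ..., n\<close> only
  \<open>p * 1, ..., p * (n div p)\<close> are not units.\<close>

lemma vabs_fact_rec:
  "vabs (of_nat (fact n) :: 'a) = (1 / real p) ^ (n div p) * vabs (of_nat (fact (n div p)) :: 'a)"
proof (induction n)
  case (Suc n)
  have p0: "p > 0" using p_gt_2 by simp
  have IH: "vabs (of_nat (fact (Suc n)) :: 'a)
      = vabs (of_nat (Suc n) :: 'a) * ((1 / real p) ^ (n div p) * vabs (of_nat (fact (n div p)) :: 'a))"
    by (simp only: fact_Suc of_nat_mult vabs_mult Suc of_nat_id)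
  show ?case
  proof (cases "p dvd Suc n")
    case True
    hence d1: "Suc n div p = Suc (n div p)" by (simp add: div_Suc dvd_eq_mod_eq_0)
    have d: "Suc n = p * Suc (n div p)" using dvd_mult_div_cancel[OF True] by (simp only: d1)
    have "vabs (of_nat (Suc n) :: 'a) = 1 / real p * vabs (of_nat (Suc (n div p)) :: 'a)"
      by (subst d) (simp only: of_nat_mult vabs_mult vabs_p)
    thus ?thesis
      unfolding IH d1 by (simp only: fact_Suc of_nat_mult vabs_mult of_nat_id power_Suc mult_ac)
  next
    case False
    hence "Suc n div p = n div p" by (simp add: div_Suc dvd_eq_mod_eq_0)
    thus ?thesis by (simp only: IH vabs_of_nat_coprime[OF False] mult_1)
  qed
qed simp

text \<open>With \<open>m = n div p\<close>, the recursion produces the exponent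
  \<open>(p - 1) m + (m - 1) = p m - 1\<close>, which is at most \<open>n - 1\<close>. Having
  \<open>n - 1\<close> instead of \<open>n\<close> is what lets the linear terms of exponential and
  logarithm dominate.\<close>

lemma vabs_fact_ge: "exp_radius ^ (n - 1) \<le> vabs (of_nat (fact n) :: 'a)"
proof (induction n rule: less_induct)
  case (less n)
  define m where "m = n div p"
  show ?case
  proof (cases "m = 0")
    case True
    thus ?thesis
      using vabs_fact_rec[of n] exp_radius_pos exp_radius_less_1 by (simp add: m_def power_le_one)
  next
    case False
    have "n > 0" using False by (cases "n = 0") (simp_all add: m_def)
    hence pm: "p * m \<le> n" "m < n"
      using p_gt_2 by (auto simp: m_def intro!: div_less_dividend)
    have "(p - 1) * m + (m - 1) = p * m - 1"
      using False p_gt_2 by (cases m; cases p) (auto simp: algebra_simps)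
    hence "exp_radius ^ (n - 1) \<le> exp_radius ^ ((p - 1) * m + (m - 1))"
      using exp_radius_pos exp_radius_less_1 pm by (intro power_decreasing) auto
    also have "\<dots> = (1 / real p) ^ m * exp_radius ^ (m - 1)"
      by (simp only: power_add power_mult exp_radius_power)
    also have "\<dots> \<le> (1 / real p) ^ m * vabs (of_nat (fact m) :: 'a)"
      by (intro mult_left_mono less.IH pm) simp
    also have "\<dots> = vabs (of_nat (fact n) :: 'a)"
      using vabs_fact_rec[of n] by (simp only: m_def)
    finally show ?thesis .
  qed
qed

lemma vabs_fact_ge': "exp_radius ^ n \<le> vabs (of_nat (fact n) :: 'a)"
proof -
  have "exp_radius ^ n \<le> exp_radius ^ (n - 1)" using exp_radius_pos exp_radius_less_1 by (intro power_decreasing) auto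
  thus ?thesis using vabs_fact_ge[of n] by simp
qed

lemma vabs_of_nat_ge: "exp_radius ^ (n - 1) \<le> vabs (of_nat n :: 'a)" if "n > 0"
proof -
  have "of_nat (fact n) = of_nat n * (of_nat (fact (n - 1)) :: 'a)"
    using that by (simp only: fact_reduce of_nat_mult of_nat_id)
  hence "vabs (of_nat (fact n) :: 'a) \<le> vabs (of_nat n :: 'a) * 1"
    by (simp only: vabs_mult) (intro mult_left_mono vabs_of_nat_le_1 vabs_nonneg)
  thus ?thesis using vabs_fact_ge[of n] by simp
qed

lemma geometric_null: "null g" if "\<And>n. vabs (g n) \<le> (a / exp_radius) ^ n" "0 \<le> a" "a < exp_radius"
  using that exp_radius_pos by (intro null_dominated[OF LIMSEQ_power_zero]) auto

section \<open>The exponential series\<close>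

lemma vabs_exp_term_le: "vabs (x ^ n / of_nat (fact n) :: 'a) \<le> (vabs x / exp_radius) ^ n"
  unfolding vabs_divide vabs_power power_divide
  using vabs_fact_ge'[of n] exp_radius_pos by (intro divide_left_mono) (auto intro!: mult_pos_pos)

text \<open>The argument is put into the coefficients and the evaluation is at 1, so that the
  addition theorem becomes a product of formal series.\<close>

lemma Cp_exp_eq_eval: "Cp_exp x = fps_eval (fps_exp x) (1 :: 'a)"
  by (simp add: Cp_exp_def fps_eval_def)

lemma fps_conv_exp: "fps_conv (fps_exp x) (1 :: 'a)" if "vabs x < exp_radius"
  unfolding fps_conv_def using vabs_exp_term_le[of x] that
  by (intro geometric_null[of _ "vabs x"]) simp_all

lemma Cp_exp_add: "Cp_exp (x + y) = Cp_exp x * Cp_exp (y :: 'a)" if "vabs x < exp_radius" "vabs y < exp_radius"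
  using that by (simp only: Cp_exp_eq_eval fps_exp_add_mult fps_eval_mult fps_conv_exp)

lemma Cp_exp_0 [simp]: "Cp_exp 0 = (1 :: 'a)"
  by (simp add: Cp_exp_eq_eval fps_eval_one)

text \<open>The linear term dominates: the terms from \<open>n = 2\<close> on are bounded by
  \<open>k |x|\<close> with \<open>k < 1\<close>, which cannot cancel \<open>x\<close> unless
  \<open>x = 0\<close>.\<close>

lemma Cp_exp_eq_1D: "x = 0" if exp: "Cp_exp x = (1 :: 'a)" and x: "vabs x \<le> 1 / real p"
proof (rule ccontr)
  assume "x \<noteq> 0"
  define k where "k = (1 / real p) / exp_radius"
  have k: "0 \<le> k" "k < 1" using inverse_p_less_exp_radius exp_radius_pos by (simp_all add: k_def del: divide_divide_eq_left)
  have "vabs (suminf (\<lambda>n. x ^ n / of_nat (fact n)) - (\<Sum>n<2. x ^ n / of_nat (fact n))) \<le> vabs x * k"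
  proof (rule suminf_tail_le)
    show "null (\<lambda>n. x ^ n / of_nat (fact n))"
      using vabs_exp_term_le[of x] x inverse_p_less_exp_radius by (intro geometric_null[of _ "vabs x"]) simp_all
    show "0 \<le> vabs x * k" using k by simp
    fix n :: nat assume "2 \<le> n"
    have "vabs (x ^ n / of_nat (fact n)) \<le> vabs x ^ n / exp_radius ^ (n - 1)"
      unfolding vabs_divide vabs_power
      using vabs_fact_ge[of n] exp_radius_pos by (intro divide_left_mono) (auto intro!: mult_pos_pos)
    also have "\<dots> = vabs x * (vabs x / exp_radius) ^ (n - 1)"
      using \<open>2 \<le> n\<close> by (cases n) (simp_all add: power_divide)
    also have "\<dots> \<le> vabs x * k ^ (n - 1)"
      using x exp_radius_pos unfolding k_def by (intro mult_left_mono power_mono divide_right_mono) simp_all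
    also have "\<dots> \<le> vabs x * k ^ 1"
      using k \<open>2 \<le> n\<close> by (intro mult_left_mono power_decreasing) simp_all
    finally show "vabs (x ^ n / of_nat (fact n)) \<le> vabs x * k" by simp
  qed
  hence "vabs x \<le> vabs x * k"
    using exp by (simp add: Cp_exp_def numeral_2_eq_2)
  thus False using k \<open>x \<noteq> 0\<close> by simp
qed

lemma Cp_exp_inj:
  assumes "Cp_exp x = Cp_exp (y :: 'a)" "vabs x \<le> 1 / real p" "vabs y \<le> 1 / real p"
  shows "x = y"
proof -
  have exp_radius: "vabs x < exp_radius" "vabs (- y) < exp_radius" "vabs y < exp_radius"
    using assms inverse_p_less_exp_radius by simp_all
  have "Cp_exp (x - y) = Cp_exp x * Cp_exp (- y)" using Cp_exp_add[OF exp_radius(1,2)] by simp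
  also have "\<dots> = Cp_exp (y + - y)" by (simp only: assms(1) Cp_exp_add[OF exp_radius(3,2)])
  finally have "Cp_exp (x - y) = 1" by simp
  moreover have "vabs (x - y) \<le> 1 / real p" using vabs_diff_le[of x y] assms by simp
  ultimately show ?thesis using Cp_exp_eq_1D by force
qed

section \<open>The logarithm series\<close>

lemma fps_nth_ln: "fps_nth (fps_ln 1) n * y ^ n = (if n = 0 then 0 else (- 1) ^ (n - 1) * y ^ n / of_nat n :: 'a)"
  by (simp add: fps_ln_nth)

lemma vabs_minus_one_power [simp]: "vabs ((- 1) ^ n :: 'a) = 1"
  by (simp add: vabs_power)

text \<open>Both come from \<open>vabs_of_nat_ge\<close>. The first bound gives the size of the
  logarithm and the uniform bound for \<open>fps_eval_compose\<close>, the second gives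
  convergence.\<close>

lemma vabs_ln_term_le: "vabs (fps_nth (fps_ln 1) n * y ^ n :: 'a) \<le> vabs y"
  and vabs_ln_term_le': "vabs (fps_nth (fps_ln 1) n * y ^ n :: 'a) \<le> (vabs y / exp_radius) ^ n"
  if y: "vabs y \<le> 1 / real p"
proof -
  have "vabs (fps_nth (fps_ln 1) n * y ^ n) \<le> vabs y * (vabs y / exp_radius) ^ (n - 1)" if "n > 0"
  proof -
    have "vabs (fps_nth (fps_ln 1) n * y ^ n) = vabs y ^ n / vabs (of_nat n :: 'a)"
      using that by (simp only: fps_nth_ln) (simp add: vabs_mult vabs_divide vabs_power)
    also have "\<dots> \<le> vabs y ^ n / exp_radius ^ (n - 1)"
      using vabs_of_nat_ge[OF that] exp_radius_pos that by (intro divide_left_mono) (auto intro!: mult_pos_pos)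
    also have "\<dots> = vabs y * (vabs y / exp_radius) ^ (n - 1)"
      using that by (cases n) (simp_all add: power_divide)
    finally show ?thesis .
  qed note * = this
  have yr: "0 \<le> vabs y / exp_radius" "vabs y / exp_radius \<le> 1" using y inverse_p_less_exp_radius exp_radius_pos by simp_all
  show "vabs (fps_nth (fps_ln 1) n * y ^ n :: 'a) \<le> vabs y"
  proof (cases "n = 0")
    case False
    have "vabs y * (vabs y / exp_radius) ^ (n - 1) \<le> vabs y * 1"
      using yr by (intro mult_left_mono power_le_one) simp_all
    thus ?thesis using *[of] False by simp
  qed simp
  show "vabs (fps_nth (fps_ln 1) n * y ^ n :: 'a) \<le> (vabs y / exp_radius) ^ n"
  proof (cases "n = 0")
    case False
    have "vabs y * (vabs y / exp_radius) ^ (n - 1) \<le> vabs y / exp_radius * (vabs y / exp_radius) ^ (n - 1)"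
      using yr exp_radius_pos exp_radius_less_1 by (intro mult_right_mono) (simp_all add: pos_le_divide_eq mult_left_le)
    also have "\<dots> = (vabs y / exp_radius) ^ n" using False by (cases n) simp_all
    finally show ?thesis using *[of] False by simp
  qed simp
qed

lemma fps_conv_ln: "fps_conv (fps_ln 1) (y :: 'a)" if "vabs y \<le> 1 / real p"
  unfolding fps_conv_def using vabs_ln_term_le'[OF that] that inverse_p_less_exp_radius
  by (intro geometric_null[of _ "vabs y"]) simp_all

text \<open>\<open>Cp_log1\<close> starts with the linear term at index 0, while
  \<open>fps_ln 1\<close> has a zero constant term in front; a shift by one reconciles them.\<close>

lemma Cp_log1_eq_eval: "Cp_log1 (1 + y) = fps_eval (fps_ln 1) (y :: 'a)" if "vabs y \<le> 1 / real p"
proof -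
  let ?g = "\<lambda>n. (- 1) ^ n * y ^ Suc n / of_nat (Suc n)"
  have eq: "fps_nth (fps_ln 1) n * y ^ n = (if 1 \<le> n then ?g (n - 1) else 0)" for n
    by (cases n) (simp_all only: fps_nth_ln, simp_all)
  have "null (\<lambda>n. fps_nth (fps_ln 1) (n + 1) * y ^ (n + 1))"
    using fps_conv_ln[OF that] unfolding fps_conv_def by (rule LIMSEQ_ignore_initial_segment)
  hence "null ?g" by (simp only: eq) simp
  from suminf_shift[OF this, of 1] show ?thesis
    by (simp only: Cp_log1_def fps_eval_def eq) simp
qed

lemma vabs_Cp_log1_le: "vabs (Cp_log1 u :: 'a) \<le> vabs (u - 1)" if "vabs (u - 1) \<le> 1 / real p"
  using Cp_log1_eq_eval[OF that] fps_conv_ln[OF that] vabs_ln_term_le[OF that]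
  by (auto simp: fps_eval_def fps_conv_def intro: vabs_suminf_le)

section \<open>Binomial series with exponents from the disc of radius
  \<open>p * exp_radius\<close>\<close>

lemma vabs_gbinomial_le: "vabs (s gchoose n :: 'a) \<le> (max 1 (vabs s) / exp_radius) ^ n"
proof -
  have "vabs (s - of_nat i) \<le> max 1 (vabs s)" for i
    using vabs_diff_le[of s "of_nat i"] vabs_of_nat_le_1[of i] by linarith
  hence "vabs (\<Prod>i = 0..<n. s - of_nat i) \<le> (\<Prod>i = 0..<n. max 1 (vabs s))"
    unfolding vabs_prod by (intro prod_mono) simp
  moreover have "s gchoose n = (\<Prod>i = 0..<n. s - of_nat i) / of_nat (fact n)"
    by (simp add: gbinomial_prod_rev)
  ultimately show ?thesis
    unfolding power_divide using vabs_fact_ge'[of n] exp_radius_pos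
    by (simp only: vabs_divide) (intro frac_le; simp)
qed

text \<open>Here the size of \<open>Dp p\<close> enters: it puts \<open>max 1 |s| * |y|\<close>
  below \<open>exp_radius\<close>, so that a geometric series dominates.\<close>

lemma gbinomial_term_bound:
  assumes "vabs s < real p * exp_radius" "vabs y \<le> 1 / real p"
  shows "\<exists>a. 0 \<le> a \<and> a < exp_radius \<and> (\<forall>n. vabs ((s gchoose n) * y ^ n :: 'a) \<le> (a / exp_radius) ^ n)"
proof (intro exI conjI allI)
  let ?a = "max 1 (vabs s) * vabs y"
  show "0 \<le> ?a" by simp
  have "?a \<le> max 1 (vabs s) * (1 / real p)" using assms by (intro mult_left_mono) simp_all
  also have "\<dots> < exp_radius" using assms inverse_p_less_exp_radius p_gt_2 by (simp add: max_def field_simps)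
  finally show "?a < exp_radius" .
  fix n
  have "vabs ((s gchoose n) * y ^ n) \<le> (max 1 (vabs s) / exp_radius) ^ n * vabs y ^ n"
    unfolding vabs_mult vabs_power by (intro mult_right_mono vabs_gbinomial_le) simp
  thus "vabs ((s gchoose n) * y ^ n) \<le> (?a / exp_radius) ^ n" by (simp add: power_mult_distrib power_divide)
qed

lemma fps_conv_binomial: "fps_conv (fps_binomial s) (y :: 'a)"
  if "vabs s < real p * exp_radius" "vabs y \<le> 1 / real p"
  using gbinomial_term_bound[OF that] unfolding fps_conv_def fps_binomial_nth
  by (auto intro: geometric_null)

text \<open>The formal identity \<open>fps_exp_compose_ln\<close> evaluated at \<open>y\<close>. The
  terms of \<open>s log(1 + X)\<close> are bounded by \<open>|s| |y| < exp_radius\<close>, which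
  justifies the substitution.\<close>

lemma Cp_exp_log1: "Cp_exp (s * Cp_log1 (1 + y)) = fps_eval (fps_binomial s) (y :: 'a)"
  if s: "vabs s < real p * exp_radius" and y: "vabs y \<le> 1 / real p"
proof -
  let ?F = "fps_const s * fps_ln 1"
  have nth: "fps_nth ?F n * y ^ n = s * (fps_nth (fps_ln 1) n * y ^ n)" for n by simp
  have ln: "null (\<lambda>n. fps_nth (fps_ln 1) n * y ^ n)" using fps_conv_ln[OF y] by (simp only: fps_conv_def)
  let ?M = "vabs s * vabs y"
  have "?M \<le> vabs s * (1 / real p)" using y by (intro mult_left_mono) simp_all
  also have "\<dots> < exp_radius" using s p_gt_2 by (simp add: field_simps)
  finally have M: "?M < exp_radius" .
  have "fps_eval (fps_exp 1 oo ?F) y = fps_eval (fps_exp 1) (fps_eval ?F y)"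
  proof (rule fps_eval_compose)
    show "fps_conv ?F y" unfolding fps_conv_def nth using LIMSEQ_mult_vabs[OF ln] by simp
    show "vabs (fps_nth ?F n * y ^ n) \<le> ?M" for n
      unfolding nth vabs_mult[of s] by (intro mult_left_mono vabs_ln_term_le y) simp
    have "vabs (fps_nth (fps_exp 1 :: 'a fps) k) * ?M ^ k \<le> (?M / exp_radius) ^ k" for k
    proof -
      have "vabs (fps_nth (fps_exp 1 :: 'a fps) k) * ?M ^ k = vabs ((s * y) ^ k / of_nat (fact k))"
        by (simp add: vabs_divide vabs_power vabs_mult)
      thus ?thesis using vabs_exp_term_le[of "s * y" k] by (simp add: vabs_mult)
    qed
    thus "(\<lambda>k. vabs (fps_nth (fps_exp 1 :: 'a fps) k) * ?M ^ k) \<longlonglongrightarrow> 0"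
      using M exp_radius_pos by (intro real_tendsto_sandwich[OF _ _ tendsto_const LIMSEQ_power_zero[of "?M / exp_radius"]]) simp_all
  qed simp
  moreover have "fps_eval ?F y = s * Cp_log1 (1 + y)"
    unfolding fps_eval_def nth suminf_mult_vabs[OF ln] by (simp only: Cp_log1_eq_eval[OF y] fps_eval_def)
  moreover have "fps_eval (fps_exp 1) x = Cp_exp x" for x :: 'a
    by (simp add: fps_eval_def Cp_exp_def)
  ultimately show ?thesis by (simp only: fps_exp_compose_ln)
qed

lemma fps_eval_binomial_of_nat: "fps_eval (fps_binomial (of_nat m)) y = (1 + y :: 'a) ^ m"
proof -
  have "fps_eval (fps_binomial (of_nat m)) y = (\<Sum>n\<le>m. of_nat (m choose n) * y ^ n)"
    unfolding fps_eval_def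
    by (subst suminf_finite[of "{..m}"]) (simp_all flip: binomial_gbinomial add: binomial_eq_0)
  also have "\<dots> = (1 + y) ^ m"
    using binomial_ring[of y 1 m] by (simp add: add.commute)
  finally show ?thesis .
qed

lemma one_less_p_exp_radius: "1 < real p * exp_radius"
  using inverse_p_less_exp_radius p_gt_2 by (simp add: field_simps)

lemma Cp_exp_log1_self: "Cp_exp (Cp_log1 u) = (u :: 'a)" if "vabs (u - 1) \<le> 1 / real p"
  using Cp_exp_log1[of 1 "u - 1"] that fps_eval_binomial_of_nat[of 1 "u - 1"] one_less_p_exp_radius by simp

lemma vabs_mult_minus_one_le:
  "vabs (u * v - 1 :: 'a) \<le> 1 / real p" if "vabs (u - 1) \<le> 1 / real p" "vabs (v - 1) \<le> 1 / real p"
proof -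
  have "1 / real p < 1" using p_gt_2 by simp
  hence "vabs u \<le> 1" using vabs_add_le[of "u - 1" 1] that by simp
  hence "vabs (u * (v - 1)) \<le> 1 * (1 / real p)"
    using that unfolding vabs_mult by (intro mult_mono) simp_all
  thus ?thesis
    using vabs_add_le[of "u * (v - 1)" "u - 1"] that by (simp add: algebra_simps)
qed

text \<open>Both sides have exponential \<open>u v\<close>, and the exponential is injective on the
  disc of radius \<open>1/p\<close>.\<close>

lemma Cp_log1_mult: "Cp_log1 (u * v) = Cp_log1 u + Cp_log1 (v :: 'a)"
  if u: "vabs (u - 1) \<le> 1 / real p" and v: "vabs (v - 1) \<le> 1 / real p"
proof (rule Cp_exp_inj)
  note uv = vabs_mult_minus_one_le[OF u v]
  have le: "vabs (Cp_log1 u) \<le> 1 / real p" "vabs (Cp_log1 v) \<le> 1 / real p"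
    using u v vabs_Cp_log1_le order_trans by blast+
  show "Cp_exp (Cp_log1 (u * v)) = Cp_exp (Cp_log1 u + Cp_log1 v)"
    using le inverse_p_less_exp_radius by (simp add: Cp_exp_add Cp_exp_log1_self uv u v)
  show "vabs (Cp_log1 (u * v)) \<le> 1 / real p"
    using uv vabs_Cp_log1_le order_trans by blast
  show "vabs (Cp_log1 u + Cp_log1 v) \<le> 1 / real p"
    using vabs_add_le[of "Cp_log1 u" "Cp_log1 v"] le by simp
qed

lemma vabs_power_minus_one_le: "vabs (u ^ n - 1 :: 'a) \<le> 1 / real p" if "vabs (u - 1) \<le> 1 / real p"
  by (induction n) (simp_all add: vabs_mult_minus_one_le that)

lemma Cp_log1_power: "Cp_log1 (u ^ n) = of_nat n * Cp_log1 (u :: 'a)" if "vabs (u - 1) \<le> 1 / real p"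
proof (induction n)
  case 0
  show ?case using Cp_log1_mult[of 1 1] by simp
next
  case (Suc n)
  thus ?case
    using Cp_log1_mult[OF that vabs_power_minus_one_le[OF that]] by (simp add: algebra_simps)
qed

subsection \<open>The Iwasawa logarithm at integers prime to \<open>p\<close>\<close>

text \<open>For an integer, absolute value below 1 already means divisibility by \<open>p\<close>.
  This gap keeps the logarithms of integers inside the disc of radius \<open>1/p\<close>.\<close>

lemma vabs_of_nat_minus_one_le: "vabs (of_nat n - 1 :: 'a) \<le> 1 / real p" if "n > 0" "vabs (of_nat n - 1 :: 'a) < 1"
proof -
  have "of_nat n - 1 = (of_nat (n - 1) :: 'a)" using that(1) by (simp add: of_nat_diff)
  thus ?thesis using that(2) vabs_of_nat_dvd vabs_of_nat_less_1_iff by metis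
qed

lemma vabs_fermat_le: "vabs (of_nat c ^ (p - 1) - 1 :: 'a) \<le> 1 / real p" if "\<not> p dvd c"
proof -
  have "c > 0" using that by (cases "c = 0") auto
  hence "of_nat c ^ (p - 1) - 1 = (of_nat (c ^ (p - 1) - 1) :: 'a)" by (simp add: of_nat_diff)
  thus ?thesis using vabs_of_nat_dvd[OF fermat_diff_dvd[OF that]] by simp
qed

lemma vabs_powi_p_eq_1D: "k = 0" if "vabs (of_nat p powi k :: 'a) = 1"
proof -
  have *: "n = 0" if "(1 / real p) ^ n = 1" for n
    using that p_gt_2 power_eq_1_iff[of "1 / real p" n] by auto
  show ?thesis
  proof (cases "k \<ge> 0")
    case True
    thus ?thesis using that *[of "nat k"] by (simp add: power_int_def vabs_power vabs_p)
  next
    case False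
    have "vabs (inverse (of_nat p) ^ nat (- k) :: 'a) = 1" using that False by (simp add: power_int_def)
    hence "inverse (1 / real p) ^ nat (- k) = 1"
      by (simp only: inverse_eq_divide vabs_power vabs_divide vabs_p vabs_one)
    hence "(1 / real p) ^ nat (- k) = 1" by (metis inverse_1 inverse_inverse_eq power_inverse)
    thus ?thesis using *[of "nat (- k)"] False by simp
  qed
qed

text \<open>Fermat provides the representation with exponent \<open>p - 1\<close> and
  \<open>k = 0\<close>. Any other one must give the same value.\<close>

lemma iwasawa_log_of_nat:
  "iwasawa_log p (of_nat c) = Cp_log1 (of_nat c ^ (p - 1)) / (of_nat (p - 1) :: 'a)" if c: "\<not> p dvd c"
  unfolding iwasawa_log_def
proof (rule the_equality)
  have "1 / real p < 1" using p_gt_2 by simp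
  thus "\<exists>(n::nat) (k::int) u. n > 0 \<and> vabs (u - 1) < 1 \<and> (of_nat c :: 'a) ^ n = of_nat p powi k * u \<and>
      Cp_log1 (of_nat c ^ (p - 1)) / of_nat (p - 1) = Cp_log1 u / of_nat n"
    using order.strict_trans1[OF vabs_fermat_le[OF c]] p_gt_2
    by (intro exI[of _ "p - 1"] exI[of _ 0] exI[of _ "of_nat c ^ (p - 1)"]) simp
  fix l :: 'a
  assume "\<exists>(n::nat) (k::int) u. n > 0 \<and> vabs (u - 1) < 1 \<and> of_nat c ^ n = of_nat p powi k * u \<and> l = Cp_log1 u / of_nat n"
  then obtain n k u where n: "n > 0" and u: "vabs (u - 1) < 1" and eq: "of_nat c ^ n = of_nat p powi k * u"
    and l: "l = Cp_log1 u / of_nat n" by blast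
  have "vabs (1 + (u - 1)) = vabs (1 :: 'a)"
    using u by (intro vabs_add_eq_left) simp
  hence "vabs (of_nat p powi k :: 'a) = vabs (of_nat c ^ n :: 'a)"
    by (simp add: eq vabs_mult)
  hence "k = 0" using vabs_of_nat_coprime[OF c] by (intro vabs_powi_p_eq_1D) (simp add: vabs_power)
  \<comment> \<open>Now \<open>u\<close> is the integer \<open>c ^ n\<close>, so
    \<open>|u - 1| < 1\<close> sharpens to \<open>|u - 1| \<le> 1/p\<close> and
    \<open>Cp_log1_power\<close> applies. The two logarithms are compared through
    \<open>c ^ (n * (p - 1))\<close>.\<close>
  with eq have u_eq: "u = of_nat (c ^ n)" by simp
  have "c > 0" using c by (cases "c = 0") auto
  hence u_le: "vabs (u - 1) \<le> 1 / real p"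
    using u vabs_of_nat_minus_one_le[of "c ^ n"] by (simp add: u_eq)
  have "of_nat n * Cp_log1 (of_nat c ^ (p - 1)) = Cp_log1 ((of_nat c ^ (p - 1)) ^ n :: 'a)"
    by (rule Cp_log1_power[symmetric, OF vabs_fermat_le[OF c]])
  also have "(of_nat c ^ (p - 1)) ^ n = u ^ (p - 1)"
    by (simp add: u_eq flip: power_mult) (simp add: mult.commute)
  also have "Cp_log1 (u ^ (p - 1)) = of_nat (p - 1) * Cp_log1 u"
    by (rule Cp_log1_power[OF u_le])
  finally show "l = Cp_log1 (of_nat c ^ (p - 1)) / of_nat (p - 1)"
    using n p_gt_2 by (simp add: l field_simps)
qed

lemma vabs_p_minus_1: "vabs (of_nat (p - 1) :: 'a) = 1"
proof (rule vabs_of_nat_coprime)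
  show "\<not> p dvd p - 1" using p_gt_2 by (auto dest: dvd_imp_le)
qed

lemma vabs_iwasawa_log_le: "vabs (iwasawa_log p (of_nat c) :: 'a) \<le> 1 / real p" if "\<not> p dvd c"
  using vabs_Cp_log1_le[OF vabs_fermat_le[OF that]] vabs_fermat_le[OF that]
  unfolding iwasawa_log_of_nat[OF that] vabs_divide vabs_p_minus_1 by simp

text \<open>The factor \<open>p - 1\<close> cancels the denominator of the Iwasawa logarithm, and
  the exponential undoes the logarithm.\<close>

lemma angle_pow_of_nat: "angle_pow p c (of_nat (k * (p - 1))) = (of_nat c ^ (k * (p - 1)) :: 'a)" if "\<not> p dvd c"
proof -
  have "of_nat (k * (p - 1)) * iwasawa_log p (of_nat c :: 'a) = Cp_log1 ((of_nat c ^ (p - 1)) ^ k)"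
    using p_gt_2 unfolding iwasawa_log_of_nat[OF that] Cp_log1_power[OF vabs_fermat_le[OF that]] by simp
  thus ?thesis
    unfolding angle_pow_def
    using Cp_exp_log1_self[OF vabs_power_minus_one_le[OF vabs_fermat_le[OF that]], of k]
    by (simp add: mult.commute flip: power_mult)
qed

text \<open>\<open>f - c = -c (1 - f/c)\<close>. The sign disappears because \<open>p - 1\<close> is
  even, and the last factor is close to 1 because \<open>p\<close> divides \<open>f\<close>.\<close>

lemma iwasawa_log_diff:
  assumes c: "\<not> p dvd c" and f: "p dvd f" and cf: "c < f"
  shows "iwasawa_log p (of_nat (f - c)) = iwasawa_log p (of_nat c) + Cp_log1 (1 + - of_nat f / of_nat c :: 'a)"
proof -
  have fc: "\<not> p dvd f - c" using c f cf dvd_diffD1[of p f c] by auto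
  have c0: "(of_nat c :: 'a) \<noteq> 0" using c by (cases "c = 0") auto
  define v where "v = (1 + - of_nat f / of_nat c :: 'a)"
  have v: "vabs (v - 1) \<le> 1 / real p"
    using vabs_of_nat_dvd[OF f] by (simp add: v_def vabs_divide vabs_of_nat_coprime[OF c])
  have "of_nat (f - c) = - (of_nat c * v)"
    using cf c0 by (simp add: v_def of_nat_diff field_simps)
  moreover have "even (p - 1)" using odd_p by simp
  ultimately have "of_nat (f - c) ^ (p - 1) = of_nat c ^ (p - 1) * v ^ (p - 1)"
    by (simp add: power_mult_distrib)
  hence "Cp_log1 (of_nat (f - c) ^ (p - 1)) = Cp_log1 (of_nat c ^ (p - 1)) + of_nat (p - 1) * Cp_log1 v"
    by (simp only: Cp_log1_mult[OF vabs_fermat_le[OF c] vabs_power_minus_one_le[OF v]] Cp_log1_power[OF v])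
  thus ?thesis
    using p_gt_2 unfolding iwasawa_log_of_nat[OF c] iwasawa_log_of_nat[OF fc] v_def[symmetric]
    by (simp only: add_divide_distrib) simp
qed

lemma angle_pow_diff:
  assumes c: "\<not> p dvd c" and f: "p dvd f" and cf: "c < f" and s: "vabs s < real p * exp_radius"
  shows "angle_pow p (f - c) s = angle_pow p c s * fps_eval (fps_binomial s) (- of_nat f / of_nat c :: 'a)"
proof -
  have y: "vabs (- of_nat f / of_nat c :: 'a) \<le> 1 / real p"
    using vabs_of_nat_dvd[OF f] by (simp add: vabs_divide vabs_of_nat_coprime[OF c])
  have small: "vabs (s * x) < exp_radius" if "vabs x \<le> 1 / real p" for x
  proof -
    have "vabs (s * x) \<le> vabs s * (1 / real p)"
      unfolding vabs_mult using that by (intro mult_left_mono) simp_all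
    also have "\<dots> < exp_radius" using s p_gt_2 by (simp add: field_simps)
    finally show ?thesis .
  qed
  have "vabs (Cp_log1 (1 + - of_nat f / of_nat c :: 'a)) \<le> 1 / real p"
    using vabs_Cp_log1_le[of "1 + - of_nat f / of_nat c"] y by simp
  thus ?thesis
    unfolding angle_pow_def iwasawa_log_diff[OF c f cf] distrib_left
    by (simp only: Cp_exp_add small vabs_iwasawa_log_le[OF c] Cp_exp_log1[OF s y])
qed

subsection \<open>Bernoulli series\<close>

text \<open>A weak form of von Staudt-Clausen: \<open>p B_n\<close> is \<open>p\<close>-integral. In
  Faulhaber's formula with \<open>p\<close> summands \<open>p B_n\<close> is the term
  \<open>k = 0\<close>; the others are integral by induction, as
  \<open>p ^ (k + 1) / (k + 1)\<close> has absolute value at most \<open>1/p\<close>.\<close>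

lemma vabs_bernoulli_le: "vabs (of_rat (bernoulli n) :: 'a) \<le> real p"
proof (induction n rule: less_induct)
  case (less n)
  let ?t = "\<lambda>k. of_nat (n choose k) * of_rat (bernoulli (n - k)) * (of_nat p ^ Suc k / of_nat (Suc k)) :: 'a"
  have p0: "real p > 0" using p_gt_2 by simp
  have le: "vabs (?t k) \<le> 1" if "k \<in> {1..n}" for k
  proof -
    have "vabs (of_nat p ^ Suc k / of_nat (Suc k) :: 'a) \<le> 1 / real p"
    proof -
      have "(1 / real p) ^ k \<le> vabs (of_nat (Suc k) :: 'a)"
        using vabs_of_nat_ge[of "Suc k"] inverse_p_power_le[of k] by simp
      hence "(1 / real p) ^ k / vabs (of_nat (Suc k) :: 'a) \<le> 1"
        by (intro divide_le_eq_1[THEN iffD2]) (simp del: of_nat_Suc)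
      from mult_left_mono[OF this, of "1 / real p"] show ?thesis
        by (simp add: vabs_divide vabs_power vabs_mult vabs_p del: of_nat_Suc)
    qed
    moreover have "vabs (of_rat (bernoulli (n - k)) :: 'a) \<le> real p"
      using that by (intro less.IH) auto
    ultimately have "vabs (?t k) \<le> 1 * real p * (1 / real p)"
      unfolding vabs_mult by (intro mult_mono vabs_of_nat_le_1) simp_all
    thus ?thesis using p0 by simp
  qed
  have "(\<Sum>k\<le>n. ?t k) = ?t 0 + (\<Sum>k\<in>{1..n}. ?t k)"
    by (simp only: sum.atLeast0_atMost_Suc_shift atMost_atLeast0 One_nat_def sum.atLeast_Suc_atMost[OF le0])
  hence "of_rat (bernoulli n) * of_nat p = of_nat (\<Sum>a<p. a ^ n) - (\<Sum>k\<in>{1..n}. ?t k)"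
    using bernoulli_power_sum[of n p, where 'a='a] by (simp add: algebra_simps)
  moreover have "vabs (\<Sum>k\<in>{1..n}. ?t k) \<le> 1"
    by (intro vabs_sum_le le) simp_all
  hence "vabs (of_nat (\<Sum>a<p. a ^ n) - (\<Sum>k\<in>{1..n}. ?t k)) \<le> 1"
    by (intro order_trans[OF vabs_diff_le] max.boundedI vabs_of_nat_le_1)
  ultimately have "vabs (of_rat (bernoulli n) * of_nat p :: 'a) \<le> 1" by simp
  thus ?case using p0 by (simp add: vabs_mult vabs_p field_simps)
qed

lemma vabs_diff_of_nat_less: "vabs (s - of_nat j :: 'a) < real p * exp_radius" if "vabs s < real p * exp_radius"
  using vabs_diff_le[of s "of_nat j"] vabs_of_nat_le_1[of j] that one_less_p_exp_radius by linarith

text \<open>The identity comes from \<open>binom(s,j) binom(s-j,i) = binom(s,j+i) binom(j+i,j)\<close> after expanding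
  \<open>(1 + y)\<^sup>s\<^sup>-\<^sup>j\<close>.\<close>
lemma bernoulli_series_reflect:
  assumes s: "vabs s < real p * exp_radius" and y: "vabs y \<le> 1 / real p"
  shows "fps_eval (fps_binomial s) y * (\<Sum>j. (s gchoose j) * (y / (1 + y)) ^ j * of_rat (bernoulli j))
    = (\<Sum>n. (s gchoose n) * (- y) ^ n * of_rat (bernoulli n) :: 'a)"
proof -
  define B where "B j = (of_rat (bernoulli j) :: 'a)" for j
  define w where "w n = (s gchoose n) * y ^ n" for n
  define a where "a j i = (s gchoose j) * y ^ j * B j * ((s - of_nat j gchoose i) * y ^ i)" for j i
  have "vabs y < 1" using y inverse_p_less_exp_radius exp_radius_less_1 by linarith
  hence y1: "vabs (1 + y) = 1" using vabs_add_eq_left[of y 1] by simp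
  hence y1': "1 + y \<noteq> 0" using vabs_zero by force
  have yy: "vabs (y / (1 + y)) \<le> 1 / real p" using y y1 by (simp add: vabs_divide)
  have B_le: "vabs (B j) \<le> real p" for j by (simp add: B_def vabs_bernoulli_le)
  have null_w: "null w"
    using fps_conv_binomial[OF s y] by (simp add: fps_conv_def w_def[abs_def])
  have null_wB: "null (\<lambda>j. (s gchoose j) * (y / (1 + y)) ^ j * B j)"
  proof (rule null_dominated)
    have "null (\<lambda>j. (s gchoose j) * (y / (1 + y)) ^ j)"
      using fps_conv_binomial[OF s yy] by (simp add: fps_conv_def)
    thus "(\<lambda>j. vabs ((s gchoose j) * (y / (1 + y)) ^ j) * real p) \<longlonglongrightarrow> 0"
      unfolding null_iff_vabs by (rule tendsto_mult_left_zero)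
    show "vabs ((s gchoose j) * (y / (1 + y)) ^ j * B j) \<le> vabs ((s gchoose j) * (y / (1 + y)) ^ j) * real p" for j
      unfolding vabs_mult[of _ "B j"] by (intro mult_left_mono B_le) simp
  qed
  \<comment> \<open>In this form all decay sits in \<open>w (j + i)\<close>, and the other factor is
    bounded by \<open>p\<close>; hence the array is null in both indices.\<close>
  have a_eq: "a j i = w (j + i) * (of_nat (j + i choose j) * B j)" for j i
  proof -
    have "(s gchoose j) * (s - of_nat j gchoose i) = (s gchoose (j + i)) * of_nat (j + i choose j)"
      using gbinomial_trinomial_revision[of j "j + i" s] by (simp add: binomial_gbinomial)
    moreover have "a j i = ((s gchoose j) * (s - of_nat j gchoose i)) * (y ^ (j + i) * B j)"
      by (simp add: a_def power_add mult_ac)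
    ultimately show ?thesis by (simp add: w_def mult_ac)
  qed
  have "null2 a"
    unfolding null2_def
  proof (intro allI impI)
    fix e :: real assume "e > 0"
    hence "e / real p > 0" using p_gt_2 by simp
    then obtain N where N: "\<And>n. n \<ge> N \<Longrightarrow> vabs (w n) < e / real p"
      using null_w unfolding null_iff by meson
    have "vabs (a j i) < e" if "N \<le> j \<or> N \<le> i" for j i
    proof -
      have "vabs (of_nat (j + i choose j) * B j) \<le> 1 * real p"
        unfolding vabs_mult by (intro mult_mono vabs_of_nat_le_1 B_le) simp_all
      hence "vabs (a j i) \<le> vabs (w (j + i)) * real p"
        unfolding a_eq vabs_mult[of "w (j + i)"] by (intro mult_left_mono) simp_all
      also have "\<dots> < e" using N[of "j + i"] that p_gt_2 by (auto simp: pos_less_divide_eq)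
      finally show ?thesis .
    qed
    thus "\<exists>N. \<forall>i j. N \<le> i \<or> N \<le> j \<longrightarrow> vabs (a i j) < e" by blast
  qed
  have "fps_eval (fps_binomial s) y * (\<Sum>j. (s gchoose j) * (y / (1 + y)) ^ j * B j)
      = (\<Sum>j. fps_eval (fps_binomial s) y * ((s gchoose j) * (y / (1 + y)) ^ j * B j))"
    by (rule suminf_mult_vabs[OF null_wB, symmetric])
  also have "\<dots> = (\<Sum>j. \<Sum>i. a j i)"
  proof (rule suminf_cong)
    fix j
    note sj = vabs_diff_of_nat_less[OF s, of j]
    have j: "vabs (of_nat j :: 'a) < real p * exp_radius" using vabs_of_nat_le_1[of j] one_less_p_exp_radius by linarith
    \<comment> \<open>Splitting off \<open>(1 + y) ^ j\<close> cancels the denominator of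
      \<open>(y / (1 + y)) ^ j\<close>.\<close>
    have "fps_eval (fps_binomial s) y = fps_eval (fps_binomial (s - of_nat j)) y * (1 + y) ^ j"
      using fps_eval_mult[OF fps_conv_binomial[OF sj y] fps_conv_binomial[OF j y]]
      by (simp add: fps_eval_binomial_of_nat flip: fps_binomial_add)
    hence "fps_eval (fps_binomial s) y * ((s gchoose j) * (y / (1 + y)) ^ j * B j)
        = (s gchoose j) * y ^ j * B j * fps_eval (fps_binomial (s - of_nat j)) y"
      using y1' by (simp add: power_divide)
    also have "\<dots> = (\<Sum>i. a j i)"
      unfolding a_def fps_eval_def fps_binomial_nth
      using fps_conv_binomial[OF sj y] by (intro suminf_mult_vabs[symmetric]) (simp add: fps_conv_def)
    finally show "fps_eval (fps_binomial s) y * ((s gchoose j) * (y / (1 + y)) ^ j * B j) = (\<Sum>i. a j i)" .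
  qed
  also have "\<dots> = (\<Sum>n. \<Sum>j\<le>n. a j (n - j))" by (rule suminf_diagonal[OF \<open>null2 a\<close>])
  also have "\<dots> = (\<Sum>n. (s gchoose n) * (- y) ^ n * B n)"
  proof (rule suminf_cong)
    fix n
    have "(\<Sum>j\<le>n. a j (n - j)) = w n * (\<Sum>j\<le>n. of_nat (n choose j) * B j)"
      unfolding sum_distrib_left by (intro sum.cong) (simp_all add: a_eq)
    also have "\<dots> = (s gchoose n) * (- y) ^ n * B n"
      unfolding B_def sum_binomial_bernoulli by (simp add: w_def power_minus[of y])
    finally show "(\<Sum>j\<le>n. a j (n - j)) = (s gchoose n) * (- y) ^ n * B n" .
  qed
  finally show ?thesis by (simp only: B_def)
qed

end

section \<open>Character sums of Bernoulli polynomials\<close>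

text \<open>The function \<open>H\<close> of the introductory comment. \<open>N ^ m / N\<close> is
  \<open>N ^ (m - 1)\<close> without natural subtraction; this normalisation makes the value
  independent of the modulus.\<close>

definition char_bern :: "nat \<Rightarrow> nat \<Rightarrow> 'a::field_char_0 \<Rightarrow> 'a" where
  "char_bern m N w = of_nat N ^ m / of_nat N * (\<Sum>c<N. w ^ c * bern_poly m (of_nat c / of_nat N))"

text \<open>Write the index as \<open>k N + e\<close>. The power of \<open>w\<close> depends on
  \<open>e\<close> only, and the sum over \<open>k\<close> is evaluated by the distribution
  relation.\<close>

lemma char_bern_mult:
  assumes "w ^ N = 1" "N > 0" "n > 0"
  shows "char_bern m (n * N) w = char_bern m N (w :: 'a::field_char_0)"
proof -
  let ?g = "\<lambda>c. w ^ c * bern_poly m (of_nat c / of_nat (n * N))"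
  have n0: "(of_nat n :: 'a) \<noteq> 0" "(of_nat N :: 'a) \<noteq> 0" using assms by simp_all
  have "(\<Sum>c<n * N. ?g c) = (\<Sum>k<n. \<Sum>c\<in>{k * N..<k * N + N}. ?g c)"
    by (rule sum.nat_group[symmetric])
  also have "\<dots> = (\<Sum>k<n. \<Sum>e<N. ?g (k * N + e))"
  proof (rule sum.cong[OF refl])
    fix k
    show "(\<Sum>c\<in>{k * N..<k * N + N}. ?g c) = (\<Sum>e<N. ?g (k * N + e))"
      by (rule sum.reindex_bij_witness[of _ "\<lambda>e. k * N + e" "\<lambda>c. c - k * N"]) auto
  qed
  also have "\<dots> = (\<Sum>e<N. \<Sum>k<n. ?g (k * N + e))"
    by (rule sum.swap)
  also have "\<dots> = (\<Sum>e<N. w ^ e * (of_nat n / of_nat n ^ m * bern_poly m (of_nat e / of_nat N)))"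
  proof (intro sum.cong refl)
    fix e
    have "?g (k * N + e) = w ^ e * bern_poly m (of_nat e / of_nat (n * N) + of_nat k / of_nat n)" for k
    proof -
      have "w ^ (k * N + e) = w ^ e"
        using assms(1) by (simp add: power_add mult.commute[of k] power_mult)
      moreover have "of_nat (k * N + e) / of_nat (n * N) = of_nat e / of_nat (n * N) + of_nat k / (of_nat n :: 'a)"
        using n0 by (simp add: field_simps)
      ultimately show ?thesis by simp
    qed
    moreover have "(\<Sum>k<n. bern_poly m (of_nat e / of_nat (n * N) + of_nat k / of_nat n))
        = of_nat n / of_nat n ^ m * bern_poly m (of_nat e / of_nat N :: 'a)"
      using bern_poly_distribution[OF assms(3), of m "of_nat e / of_nat (n * N) :: 'a"] n0
      by (simp add: field_simps)
    ultimately show "(\<Sum>k<n. ?g (k * N + e)) = w ^ e * (of_nat n / of_nat n ^ m * bern_poly m (of_nat e / of_nat N))"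
      by (simp flip: sum_distrib_left)
  qed
  also have "\<dots> = of_nat n / of_nat n ^ m * (\<Sum>e<N. w ^ e * bern_poly m (of_nat e / of_nat N))"
    by (simp add: sum_distrib_left mult_ac)
  finally show ?thesis
    using n0 by (simp add: char_bern_def power_mult_distrib)
qed

lemma char_bern_eq:
  "char_bern m M w = char_bern m N (w :: 'a::field_char_0)" if "w ^ M = 1" "M > 0" "w ^ N = 1" "N > 0"
  using char_bern_mult[of w M N m] char_bern_mult[of w N M m] that by (simp add: mult.commute)

text \<open>The indices divisible by \<open>p\<close>, among them 0, are \<open>p d\<close> with
  \<open>d < f div p\<close>; they form the same sum for \<open>w ^ p\<close> and modulus
  \<open>f div p\<close>. This is the removal of the Euler factor at \<open>p\<close>.\<close>

lemma char_bern_coprime_part: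
  fixes w :: "'a::field_char_0"
  assumes "p > 0" "p dvd f" "f > 0"
  shows "of_nat f ^ m / of_nat f * (\<Sum>c | 1 \<le> c \<and> c < f \<and> \<not> p dvd c. w ^ c * bern_poly m (of_nat c / of_nat f))
    = char_bern m f w - of_nat p ^ m / of_nat p * char_bern m (f div p) (w ^ p)"
proof -
  from assms obtain g where f: "f = p * g" and g: "g > 0" by (metis dvd_def gr0I mult_0_right)
  let ?t = "\<lambda>c. w ^ c * bern_poly m (of_nat c / of_nat f)"
  have p0: "(of_nat p :: 'a) \<noteq> 0" "(of_nat g :: 'a) \<noteq> 0" using assms g by simp_all
  have "(\<Sum>c<f. ?t c) = (\<Sum>c | 1 \<le> c \<and> c < f \<and> \<not> p dvd c. ?t c) + (\<Sum>c | c < f \<and> p dvd c. ?t c)"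
  proof -
    have "{..<f} = {c. 1 \<le> c \<and> c < f \<and> \<not> p dvd c} \<union> {c. c < f \<and> p dvd c}"
      by (auto simp: Suc_le_eq intro: gr0I)
    moreover have "{c. 1 \<le> c \<and> c < f \<and> \<not> p dvd c} \<inter> {c. c < f \<and> p dvd c} = {}" by auto
    ultimately show ?thesis by (simp add: sum.union_disjoint)
  qed
  moreover have "(\<Sum>c | c < f \<and> p dvd c. ?t c) = (\<Sum>d<g. (w ^ p) ^ d * bern_poly m (of_nat d / of_nat g))"
    using assms(1) p0
    by (intro sum.reindex_bij_witness[of _ "\<lambda>d. p * d" "\<lambda>c. c div p"]) (auto simp: f power_mult)
  moreover have "f div p = g" using assms(1) by (simp add: f)
  ultimately show ?thesis
    using p0 by (simp add: char_bern_def f field_simps power_mult_distrib)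
qed

section \<open>Fourier inversion on residues modulo \<open>N\<close>\<close>

lemma power_inj_below_order:
  fixes z :: "'a::field"
  assumes "\<And>n. z ^ n = 1 \<longleftrightarrow> N dvd n" "z \<noteq> 0" "z ^ i = z ^ j" "i < N" "j < N"
  shows "i = j"
proof -
  have *: "i = j" if "i \<le> j" "j < N" "z ^ i = z ^ j" for i j
  proof -
    have "z ^ i * z ^ (j - i) = z ^ i * 1"
      using that le_add_diff_inverse[OF that(1)] by (metis power_add mult_1_right)
    hence "N dvd j - i" using assms(1,2) by simp
    thus ?thesis using that by (auto dest: dvd_imp_le)
  qed
  show ?thesis using *[of i j] *[of j i] assms by (cases "i \<le> j") auto
qed

lemma sum_powers_root_of_unity:
  "(\<Sum>i<N. u ^ i) = (if u = 1 then of_nat N else (0 :: 'a::field))" if "u ^ N = 1"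
  using that by (auto simp: geometric_sum)

text \<open>Orthogonality: summing \<open>(z ^ e / v) ^ i\<close> over \<open>i\<close> gives
  \<open>N\<close> for \<open>e = a\<close> and 0 otherwise.\<close>

lemma root_of_unity_coeff:
  fixes z v :: "'a::field"
  assumes ord: "\<And>n. z ^ n = 1 \<longleftrightarrow> N dvd n" and a: "a < N" and v: "v = z ^ a"
  shows "(\<Sum>i<N. (\<Sum>e<N. (z ^ i) ^ e * g e) / v ^ i) = of_nat N * g a"
proof -
  have N: "N > 0" using a by simp
  have zN: "z ^ N = 1" by (simp add: ord)
  hence z0: "z \<noteq> 0" using N by (auto simp: power_0_left)
  have "(\<Sum>i<N. (\<Sum>e<N. (z ^ i) ^ e * g e) / v ^ i) = (\<Sum>i<N. \<Sum>e<N. g e * (z ^ e / v) ^ i)"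
    unfolding sum_divide_distrib
    by (intro sum.cong refl) (simp add: power_divide mult.commute flip: power_mult)
  also have "\<dots> = (\<Sum>e<N. g e * (\<Sum>i<N. (z ^ e / v) ^ i))"
    by (subst sum.swap) (simp add: sum_distrib_left)
  also have "\<dots> = (\<Sum>e<N. if e = a then of_nat N * g e else 0)"
  proof (intro sum.cong refl)
    fix e assume "e \<in> {..<N}"
    hence "z ^ e / v = 1 \<longleftrightarrow> e = a"
      using power_inj_below_order[OF ord z0, of e a] a z0 by (auto simp: v)
    moreover have "(z ^ e / v) ^ N = 1"
    proof -
      have "(z ^ k) ^ N = 1" for k by (simp add: ord flip: power_mult)
      thus ?thesis by (simp add: v power_divide)
    qed
    ultimately show "g e * (\<Sum>i<N. (z ^ e / v) ^ i) = (if e = a then of_nat N * g e else 0)"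
      by (simp add: sum_powers_root_of_unity)
  qed
  also have "\<dots> = of_nat N * g a" using a by simp
  finally show ?thesis .
qed

text \<open>By Euler, \<open>totient N\<close> steps of the scaling lead back to the same residue,
  so \<open>D i\<close> is multiplied by a number other than 1 and yet unchanged.\<close>

lemma periodic_scaling_eq_0:
  fixes D :: "nat \<Rightarrow> 'a::field"
  assumes scale: "\<And>i. D i = q * D (i * p)" and per: "\<And>i j. [i = j] (mod N) \<Longrightarrow> D i = D j"
    and co: "coprime p N" and N: "N > 0" and q: "\<And>n. n > 0 \<Longrightarrow> q ^ n \<noteq> 1"
  shows "D i = 0"
proof -
  have "D i = q ^ n * D (i * p ^ n)" for n
  proof (induction n)
    case (Suc n)
    thus ?case using scale[of "i * p ^ n"] by (simp add: mult_ac)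
  qed simp
  moreover have "[i * p ^ totient N = i * 1] (mod N)"
    by (intro cong_mult cong_refl euler_theorem co)
  ultimately have "D i = q ^ totient N * D i"
    using per by (metis mult.right_neutral)
  thus ?thesis using q[of "totient N"] N by (auto simp: totient_gt_0_iff)
qed

text \<open>Rational arguments have rational values, so the equation descends to the rationals and
  from there reaches the reals, where the order is available.\<close>

lemma bern_poly_eq_rat_imp:
  fixes u v :: rat
  assumes "even m" "m > 0" "0 \<le> u" "u \<le> 1" "0 \<le> v" "v \<le> 1"
    and eq: "bern_poly m (of_rat u) = bern_poly m (of_rat v :: 'a::field_char_0)"
  shows "u = v \<or> u = 1 - v"
proof -
  from eq have "bern_poly m u = bern_poly m v" by (simp flip: of_rat_bern_poly)
  hence "bern_poly m (of_rat u) = bern_poly m (of_rat v :: real)" by (simp flip: of_rat_bern_poly)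
  moreover have "(of_rat u :: real) \<in> {0..1}" "(of_rat v :: real) \<in> {0..1}"
    using assms by simp_all
  ultimately have "(of_rat u :: real) = of_rat v \<or> (of_rat u :: real) = 1 - of_rat v"
    using bern_poly_even_eqD[OF assms(1,2)] by blast
  thus ?thesis by (metis of_rat_1 of_rat_diff of_rat_eq_iff)
qed

text \<open>The values \<open>H(w) = char_bern m N w\<close> are finite Fourier coefficients of \<open>c \<mapsto> B\<^sub>m(c/N)\<close>. They can
  be recovered from \<open>H(w) - p\<^sup>m\<^sup>-\<^sup>1 H(w\<^sup>p)\<close>, because \<open>w\<close> is one of the iterated \<open>p\<close>-th powers of itself.\<close>
lemma char_bern_order_eq:
  fixes z v :: "'a::field_char_0"
  assumes z: "\<And>n. z ^ n = 1 \<longleftrightarrow> N dvd n" and v: "\<And>n. v ^ n = 1 \<longleftrightarrow> N dvd n"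
    and a: "v = z ^ a" "a < N" and N: "N > 1" and co: "coprime p N" and p: "p > 1" and m: "even m" "m > 0"
    and eq: "\<And>i. char_bern m N (z ^ i) - of_nat p ^ m / of_nat p * char_bern m N ((z ^ i) ^ p)
               = char_bern m N (v ^ i) - of_nat p ^ m / of_nat p * char_bern m N ((v ^ i) ^ p)"
  shows "a = 1 \<or> a = N - 1"
proof -
  define D where "D i = char_bern m N (z ^ i) - char_bern m N (v ^ i)" for i
  have D0: "D i = 0" for i
  proof (rule periodic_scaling_eq_0[OF _ _ co])
    show "D i = of_nat p ^ (m - 1) * D (i * p)" for i
      using eq[of i] p m by (cases m) (simp_all add: D_def power_mult algebra_simps)
    show "D i = D j" if "[i = j] (mod N)" for i j
    proof -
      have *: "u ^ i = u ^ j" if "u ^ N = 1" for u :: 'a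
      proof -
        have "u ^ k = u ^ (k mod N)" for k
          using that by (metis mod_div_decomp power_add power_mult power_one mult.commute mult_1 add.commute)
        thus ?thesis using \<open>[i = j] (mod N)\<close> by (metis cong_def)
      qed
      show ?thesis using *[of z] *[of v] z v by (simp add: D_def)
    qed
    show "N > 0" using N by simp
    fix n :: nat assume "n > 0"
    have "(of_nat p ^ (m - 1)) ^ n = (of_nat (p ^ ((m - 1) * n)) :: 'a)" by (simp add: power_mult)
    \<comment> \<open>An even positive \<open>m\<close> is at least 2; for \<open>m = 1\<close> the
      scaling factor would be 1.\<close>
    moreover have "m - 1 > 0" using m by (cases m) (auto elim!: oddE)
    hence "p ^ ((m - 1) * n) \<noteq> 1" using p \<open>n > 0\<close> by simp
    ultimately show "(of_nat p ^ (m - 1)) ^ n \<noteq> (1 :: 'a)" by (metis of_nat_eq_1_iff)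
  qed
  define g where "g e = bern_poly m (of_nat e / of_nat N :: 'a)" for e
  have "(\<Sum>e<N. (z ^ i) ^ e * g e) = (\<Sum>e<N. (v ^ i) ^ e * g e)" for i
    using D0[of i] N by (simp add: D_def char_bern_def g_def)
  \<comment> \<open>The same sums, divided by \<open>v ^ i\<close>, are inverted twice: with respect
    to \<open>z\<close>, where \<open>v = z ^ a\<close>, and with respect to \<open>v\<close>
    itself, where the exponent is 1.\<close>
  hence "of_nat N * g a = of_nat N * g 1"
    using root_of_unity_coeff[OF z a(2,1), of g] root_of_unity_coeff[OF v N, of v g]
    by (simp only: power_one_right)
  hence "g a = g 1" using N by simp
  hence "bern_poly m (of_rat (of_nat a / of_nat N)) = bern_poly m (of_rat (of_nat 1 / of_nat N) :: 'a)"
    using N by (simp add: g_def of_rat_divide)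
  hence "(of_nat a / of_nat N :: rat) = of_nat 1 / of_nat N \<or> (of_nat a / of_nat N :: rat) = 1 - of_nat 1 / of_nat N"
    using a N by (intro bern_poly_eq_rat_imp[OF m]) simp_all
  moreover have "1 - of_nat 1 / of_nat N = (of_nat (N - 1) / of_nat N :: rat)"
    using N by (simp add: of_nat_diff field_simps)
  ultimately show ?thesis using N by (auto simp: divide_cancel_right)
qed

section \<open>The group \<open>(\<rat>/\<int>)\<^sup>(\<^sup>p\<^sup>)\<close>\<close>

text \<open>Eliminates the reduced fraction: divisibility and coprimality of denominators are from
  here on checked by clearing denominators.\<close>

lemma denom_dvd_iff: "denom x dvd n \<longleftrightarrow> of_nat n * x \<in> \<int>"
proof -
  obtain a b where q: "quotient_of x = (a, b)" by force
  hence b: "b > 0" "coprime a b" "x = of_int a / of_int b"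
    using quotient_of_denom_pos quotient_of_coprime quotient_of_div by blast+
  have "of_nat n * x \<in> \<int> \<longleftrightarrow> (\<exists>k. int n * a = k * b)"
  proof
    assume "of_nat n * x \<in> \<int>"
    then obtain k where "of_nat n * x = of_int k" by (auto elim: Ints_cases)
    hence "(of_int (int n * a) :: rat) = of_int (k * b)" using b by (simp add: field_simps)
    thus "\<exists>k. int n * a = k * b" by (metis of_int_eq_iff)
  next
    assume "\<exists>k. int n * a = k * b"
    then obtain k where "int n * a = k * b" by blast
    hence "(of_int (int n * a) :: rat) = of_int (k * b)" by simp
    hence "of_nat n * x * of_int b = of_int k * of_int b" using b by (simp add: mult.commute)
    hence "of_nat n * x = of_int k" using b(1) by simp
    thus "of_nat n * x \<in> \<int>" by simp
  qed
  also have "\<dots> \<longleftrightarrow> b dvd int n * a" by (auto simp: dvd_def mult.commute)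
  also have "\<dots> \<longleftrightarrow> b dvd int n" using b(2) by (simp add: coprime_commute coprime_dvd_mult_left_iff)
  also have "\<dots> \<longleftrightarrow> denom x dvd n" using b(1) by (simp add: denom_def q flip: int_dvd_int_iff)
  finally show ?thesis by simp
qed

lemma denom_pos: "denom x > 0"
  by (simp add: denom_def quotient_of_denom_pos')

lemma denom_frac [simp]: "denom (frac x) = denom x"
proof -
  have "of_nat n * frac x \<in> \<int> \<longleftrightarrow> of_nat n * x \<in> \<int>" for n
  proof -
    have "of_nat n * x = of_nat n * frac x + of_nat n * of_int \<lfloor>x\<rfloor>"
      by (simp add: frac_def algebra_simps)
    thus ?thesis by simp
  qed
  hence *: "denom (frac x) dvd n \<longleftrightarrow> denom x dvd n" for n by (simp add: denom_dvd_iff)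
  show ?thesis using *[of "denom x"] *[of "denom (frac x)"] by (intro dvd_antisym) simp_all
qed

lemma coprime_denom: "coprime (denom x) p" if "coprime n p" "of_nat n * x \<in> \<int>"
  using that by (metis coprime_divisors denom_dvd_iff dvd_refl)

lemma denom_mult_Ints: "of_nat (denom x) * x \<in> \<int>"
  using denom_dvd_iff[of x "denom x"] by simp

lemma coprime_denom_add: "coprime (denom (x + y)) p" if "coprime (denom x) p" "coprime (denom y) p"
proof (rule coprime_denom)
  show "coprime (denom x * denom y) p" using that by simp
  have "of_nat (denom x * denom y) * (x + y)
      = of_nat (denom y) * (of_nat (denom x) * x) + of_nat (denom x) * (of_nat (denom y) * y)"
    by (simp add: algebra_simps)
  thus "of_nat (denom x * denom y) * (x + y) \<in> \<int>"
    by (simp add: denom_mult_Ints Ints_mult)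
qed

lemma coprime_denom_minus: "coprime (denom (- x)) p" if "coprime (denom x) p"
  by (rule coprime_denom[OF that]) (simp add: denom_mult_Ints)

lemma frac_eqI: "x - y \<in> \<int> \<Longrightarrow> frac x = frac (y :: rat)"
proof (elim Ints_cases)
  fix k assume "x - y = of_int k"
  hence "x = y + of_int k" by simp
  thus "frac x = frac y" by (simp add: frac_def)
qed

lemma frac_add_frac [simp]: "frac (frac x + y) = frac (x + y :: rat)" "frac (x + frac y) = frac (x + y)"
  by (rule frac_eqI, simp add: frac_def)+

lemma carrier_QZ: "x \<in> carrier (QZ p) \<longleftrightarrow> 0 \<le> x \<and> x < 1 \<and> coprime (denom x) p"
  by (simp add: QZ_def)

lemma mult_QZ [simp]: "x \<otimes>\<^bsub>QZ p\<^esub> y = frac (x + y)"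
  by (simp add: QZ_def)

lemma one_QZ [simp]: "\<one>\<^bsub>QZ p\<^esub> = 0"
  by (simp add: QZ_def)

lemma frac_in_QZ: "frac x \<in> carrier (QZ p)" if "coprime (denom x) p"
  using that by (simp add: carrier_QZ frac_lt_1)

lemma frac_QZ: "frac x = x" if "x \<in> carrier (QZ p)"
  using that by (simp add: carrier_QZ frac_eq)

lemma zero_in_QZ: "0 \<in> carrier (QZ p)"
  using coprime_denom[of 1 p 0] by (simp add: carrier_QZ)

lemma group_QZ: "group (QZ p)"
proof (rule groupI)
  fix x y assume "x \<in> carrier (QZ p)" "y \<in> carrier (QZ p)"
  thus "x \<otimes>\<^bsub>QZ p\<^esub> y \<in> carrier (QZ p)"
    using frac_in_QZ[of "x + y" p] by (simp add: carrier_QZ coprime_denom_add)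
next
  fix x assume x: "x \<in> carrier (QZ p)"
  show "\<exists>y\<in>carrier (QZ p). y \<otimes>\<^bsub>QZ p\<^esub> x = \<one>\<^bsub>QZ p\<^esub>"
    using x by (intro bexI[of _ "frac (- x)"] frac_in_QZ coprime_denom_minus) (simp_all add: carrier_QZ)
qed (simp_all add: zero_in_QZ frac_QZ add.assoc)

lemma inv_QZ: "inv\<^bsub>QZ p\<^esub> x = frac (- x)" if "x \<in> carrier (QZ p)"
  using that by (intro group.inv_equality[OF group_QZ]) (simp_all add: frac_in_QZ coprime_denom_minus carrier_QZ frac_lt_1)

lemma coprime_denom_of_nat_mult: "coprime (denom (of_nat i * x)) p" if "coprime (denom x) p"
proof (rule coprime_denom[OF that])
  have "of_nat (denom x) * (of_nat i * x) = of_nat i * (of_nat (denom x) * x)" by simp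
  thus "of_nat (denom x) * (of_nat i * x) \<in> \<int>" by (simp only: Ints_mult Ints_of_nat denom_mult_Ints)
qed

lemma frac_of_nat_mult_in_QZ: "frac (of_nat i * x) \<in> carrier (QZ p)" if "x \<in> carrier (QZ p)"
  using that by (intro frac_in_QZ coprime_denom_of_nat_mult) (simp add: carrier_QZ)

lemma QZ_hom_of_nat_mult:
  assumes "\<theta> \<in> hom (QZ p) (QZ p)" and x: "x \<in> carrier (QZ p)"
  shows "\<theta> (frac (of_nat i * x)) = frac (of_nat i * \<theta> x)"
proof (induction i)
  case 0
  have "\<theta> 0 = 0" using hom_one[OF assms(1) group_QZ group_QZ] by simp
  thus ?case by simp
next
  case (Suc i)
  have "\<theta> (frac (of_nat (Suc i) * x)) = \<theta> (frac (of_nat i * x) \<otimes>\<^bsub>QZ p\<^esub> x)"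
    by (simp add: algebra_simps)
  also have "\<dots> = \<theta> (frac (of_nat i * x)) \<otimes>\<^bsub>QZ p\<^esub> \<theta> x"
    by (rule hom_mult[OF assms(1) frac_of_nat_mult_in_QZ[OF x] x])
  also have "\<dots> = frac (of_nat (Suc i) * \<theta> x)"
    unfolding Suc by (simp add: algebra_simps)
  finally show ?case .
qed

lemma QZ_eq_of_nat_div:
  assumes "x \<in> carrier (QZ p)" "denom x dvd N" "N > 0"
  obtains i where "i < N" "x = of_nat i / of_nat N"
proof -
  from assms(2) obtain k where k: "of_nat N * x = of_int k"
    unfolding denom_dvd_iff by (auto elim: Ints_cases)
  have "0 \<le> of_nat N * x" "of_nat N * x < of_nat N * 1"
    using assms by (auto simp: carrier_QZ)
  hence "k \<ge> 0" "k < int N" by (simp_all add: k)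
  hence "nat k < N" "x = of_nat (nat k) / of_nat N"
    using k assms(3) by (auto simp: field_simps)
  thus ?thesis by (rule that)
qed

lemma one_div_in_QZ: "1 / of_nat N \<in> carrier (QZ p)" if "N > 1" "coprime N p"
  using that by (auto simp: carrier_QZ intro!: coprime_denom[of N])

lemma frac_of_nat_div: "frac (of_nat i * (1 / of_nat N)) = (of_nat i / of_nat N :: rat)" if "i < N"
  using that by (simp add: frac_eq)

text \<open>If \<open>\<theta>\<close> moved some \<open>\<gamma>\<close> and did not invert some \<open>\<gamma>'\<close>, both would be multiples of one \<open>1/N\<close>.\<close>
lemma is_pm_oneI:
  assumes hom: "\<theta> \<in> hom (QZ p) (QZ p)"
    and unit: "\<And>N. N > 1 \<Longrightarrow> coprime N p \<Longrightarrow> \<theta> (1 / of_nat N) \<in> {1 / of_nat N, 1 - 1 / of_nat N}"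
  shows "is_pm_one p \<theta>"
proof (rule ccontr)
  assume "\<not> is_pm_one p \<theta>"
  then obtain x y where x: "x \<in> carrier (QZ p)" "\<theta> x \<noteq> x" and y: "y \<in> carrier (QZ p)" "\<theta> y \<noteq> frac (- y)"
    unfolding is_pm_one_def by (metis inv_QZ)
  define N where "N = denom x * denom y"
  have N0: "N > 0" and co: "coprime N p"
    using x y by (simp_all add: N_def denom_pos carrier_QZ)
  have dvd: "denom x dvd N" "denom y dvd N" by (simp_all add: N_def)
  obtain i where i: "i < N" "x = of_nat i / of_nat N"
    using QZ_eq_of_nat_div[OF x(1) dvd(1) N0] by blast
  obtain j where j: "j < N" "y = of_nat j / of_nat N"
    using QZ_eq_of_nat_div[OF y(1) dvd(2) N0] by blast
  \<comment> \<open>\<open>unit\<close> is available only for \<open>N > 1\<close>. For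
    \<open>N = 1\<close> the class \<open>x\<close> would be 0, which \<open>\<theta>\<close>
    fixes.\<close>
  have "N \<noteq> 1"
  proof
    assume "N = 1"
    hence "x = 0" using i by simp
    thus False using x(2) hom_one[OF hom group_QZ group_QZ] by simp
  qed
  hence N: "N > 1" using N0 by simp
  note g = one_div_in_QZ[OF N co]
  consider "\<theta> (1 / of_nat N) = 1 / of_nat N" | "\<theta> (1 / of_nat N) = 1 - 1 / of_nat N"
    using unit[OF N co] by auto
  thus False
  proof cases
    case 1
    thus ?thesis
      using QZ_hom_of_nat_mult[OF hom g, of i] i x(2) by (simp only: frac_of_nat_div) 
  next
    case 2
    have "\<theta> y = frac (of_nat j * (1 - 1 / of_nat N))"
      using QZ_hom_of_nat_mult[OF hom g, of j] j by (simp only: frac_of_nat_div 2)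
    also have "\<dots> = frac (- y)"
      by (rule frac_eqI) (simp add: j algebra_simps)
    finally show False using y(2) by simp
  qed
qed

section \<open>Embeddings of \<open>\<rat>\<^sup>c\<^sup>y\<^sup>c\<^sup>,\<^sup>p\<close>\<close>

lemma is_subfield_Qcyc: "is_subfield (Qcyc p \<zeta>)"
  unfolding Qcyc_def by (rule hull_in) (auto simp: is_subfield_def)

lemma zeta_in_Qcyc: "\<zeta> \<gamma> \<in> Qcyc p \<zeta>" if "\<gamma> \<in> carrier (QZ p)"
  unfolding Qcyc_def using that by (intro hull_inc) auto

lemma subfield_power: "x ^ n \<in> F" if "is_subfield F" "x \<in> F"
  using that by (induction n) (auto simp: is_subfield_def)

lemma field_embedding_on_power:
  assumes "field_embedding_on F \<rho>" "is_subfield F" "x \<in> F"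
  shows "\<rho> (x ^ n) = \<rho> x ^ n"
  using assms subfield_power[OF assms(2,3)] by (induction n) (auto simp: field_embedding_on_def)

text \<open>If \<open>x - 1\<close> were nonzero, its inverse in \<open>F\<close> would show that
  its image is nonzero. This preserves the orders of roots of unity.\<close>

lemma field_embedding_on_eq_1_iff:
  assumes "field_embedding_on F \<rho>" "is_subfield F" "x \<in> F"
  shows "\<rho> x = 1 \<longleftrightarrow> x = 1"
proof
  assume "\<rho> x = 1"
  have add: "\<rho> (y + z) = \<rho> y + \<rho> z" and mult: "\<rho> (y * z) = \<rho> y * \<rho> z" if "y \<in> F" "z \<in> F" for y z
    using assms(1) that by (auto simp: field_embedding_on_def)
  have mem: "1 \<in> F" "-1 \<in> F" "x + -1 \<in> F" "inverse (x + -1) \<in> F"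
    using assms(2,3) unfolding is_subfield_def by blast+
  have one: "\<rho> 1 = 1" using assms(1) by (simp add: field_embedding_on_def)
  show "x = 1"
  proof (rule ccontr)
    assume "x \<noteq> 1"
    have "\<rho> (x + -1) = \<rho> x + \<rho> (-1)" by (rule add) (use assms mem in auto)
    also have "\<dots> = \<rho> (1 + -1)" by (simp only: \<open>\<rho> x = 1\<close> one add[OF mem(1,2)])
    \<comment> \<open>Additivity at \<open>0 + 0\<close> supplies
      \<open>\<rho> 0 = 0\<close>.\<close>
    also have "\<dots> = \<rho> (0 + 0) - \<rho> 0"
      using assms(2) by (subst add) (simp_all add: is_subfield_def)
    finally have "\<rho> (x + -1) = 0" by simp
    moreover have "(x + -1) * inverse (x + -1) = 1" using \<open>x \<noteq> 1\<close> by (intro right_inverse) simp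
    hence "\<rho> (x + -1) * \<rho> (inverse (x + -1)) = 1" using mult[OF mem(3,4)] one by simp
    ultimately show False by simp
  qed
qed (use assms in \<open>simp add: field_embedding_on_def\<close>)

lemma zeta_frac_of_nat_mult:
  assumes "is_zeta_system p \<zeta>" "\<gamma> \<in> carrier (QZ p)"
  shows "\<zeta> (frac (of_nat i * \<gamma>)) = \<zeta> \<gamma> ^ i"
proof (induction i)
  case 0
  have "denom 0 = 1" using denom_dvd_iff[of 0 1] by simp
  hence "\<zeta> 0 ^ 1 = 1" using assms(1) zero_in_QZ unfolding is_zeta_system_def by (metis dvd_refl)
  thus ?case by simp
next
  case (Suc i)
  have "\<zeta> (frac (of_nat (Suc i) * \<gamma>)) = \<zeta> (frac (of_nat i * \<gamma>) \<otimes>\<^bsub>QZ p\<^esub> \<gamma>)"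
    by (simp add: algebra_simps)
  also have "\<dots> = \<zeta> (frac (of_nat i * \<gamma>)) * \<zeta> \<gamma>"
    using assms frac_of_nat_mult_in_QZ[OF assms(2), of i] unfolding is_zeta_system_def by metis
  finally show ?case by (simp only: Suc power_Suc2)
qed

section \<open>The functions \<open>Z\<^sub>\<rho>\<close>\<close>

context padic_field
begin

lemma mem_Dp_iff: "\<beta> \<in> (Dp p :: 'a set) \<longleftrightarrow> vabs \<beta> < real p * exp_radius"
  by (simp add: Dp_def exp_radius_def)

lemma vabs_one_minus_Dp: "vabs (1 - \<beta> :: 'a) < real p * exp_radius" if "\<beta> \<in> Dp p"
  using vabs_diff_le[of 1 \<beta>] that one_less_p_exp_radius by (simp add: mem_Dp_iff)

lemma eventually_Dp: "eventually (\<lambda>\<beta>. \<beta> \<in> Dp p) (at (1 :: 'a))"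
proof -
  have "open (ball 0 (real p * exp_radius) :: 'a set)" by simp
  moreover have "1 \<in> (ball 0 (real p * exp_radius) :: 'a set)" using one_less_p_exp_radius by (simp add: dist_eq_vabs)
  ultimately have "eventually (\<lambda>\<beta>. \<beta> \<in> ball 0 (real p * exp_radius)) (at (1 :: 'a))"
    by (rule eventually_at_in_open')
  thus ?thesis
    by (rule eventually_mono) (simp add: mem_Dp_iff dist_eq_vabs)
qed

text \<open>Since 1 is an interior point of \<open>Dp p\<close>, formulas that agree there have the
  same limit at 1, or both have none.\<close>

lemma Z_eqI:
  assumes "\<And>\<beta>. \<beta> \<in> Dp p \<Longrightarrow> Z_formula p \<zeta> \<rho> f \<gamma> \<beta> = Z_formula p \<zeta> \<rho>' f \<gamma> \<beta>" and "\<beta> \<in> Dp p"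
  shows "Z p \<zeta> \<rho> f \<gamma> \<beta> = Z p \<zeta> \<rho>' f \<gamma> (\<beta> :: 'a)"
proof -
  have ev: "\<forall>\<^sub>F b in at (1 :: 'a). Z_formula p \<zeta> \<rho> f \<gamma> b = Z_formula p \<zeta> \<rho>' f \<gamma> b"
    by (rule eventually_mono[OF eventually_Dp assms(1)])
  have "(Z_formula p \<zeta> \<rho> f \<gamma> \<longlongrightarrow> l) (at 1) \<longleftrightarrow> (Z_formula p \<zeta> \<rho>' f \<gamma> \<longlongrightarrow> l) (at (1 :: 'a))" for l
    by (rule tendsto_cong[OF ev])
  moreover have "Lim (at 1) (Z_formula p \<zeta> \<rho> f \<gamma>) = Lim (at (1 :: 'a)) (Z_formula p \<zeta> \<rho>' f \<gamma>)"
    by (rule Lim_cong[OF ev refl])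
  ultimately show ?thesis using assms by (simp add: Z_def)
qed

text \<open>\<open>bernoulli_series_reflect\<close> at \<open>y = -f/c\<close>, for which
  \<open>y / (1 + y) = f / (f - c)\<close>; the factor \<open>(1 + y)^s\<close> comes from
  \<open>angle_pow_diff\<close>.\<close>

lemma angle_bernoulli_reflect:
  assumes c: "\<not> p dvd c" and f: "p dvd f" and cf: "c < f" and s: "vabs s < real p * exp_radius"
  shows "angle_pow p (f - c) s * (\<Sum>j. (s gchoose j) * (of_nat f / of_nat (f - c)) ^ j * of_rat (bernoulli j))
    = angle_pow p c s * (\<Sum>j. (s gchoose j) * (of_nat f / of_nat c) ^ j * of_rat (bernoulli j) :: 'a)"
proof -
  define y where "y = (- of_nat f / of_nat c :: 'a)"
  have y: "vabs y \<le> 1 / real p"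
    using vabs_of_nat_dvd[OF f] by (simp add: y_def vabs_divide vabs_of_nat_coprime[OF c])
  have c0: "(of_nat c :: 'a) \<noteq> 0" using c by (cases "c = 0") auto
  have "(of_nat (f - c) :: 'a) \<noteq> 0" using cf by simp
  moreover have "1 + y = - of_nat (f - c) / of_nat c"
    using c0 cf by (simp add: y_def of_nat_diff field_simps)
  ultimately have "y / (1 + y) = of_nat f / of_nat (f - c)"
    using c0 by (simp add: y_def del: of_nat_diff)
  moreover have "- y = of_nat f / of_nat c" by (simp add: y_def)
  ultimately show ?thesis
    using bernoulli_series_reflect[OF s y] by (simp only: angle_pow_diff[OF c f cf s] y_def[symmetric] mult.assoc)
qed

lemma Z_formula_reflect:
  assumes f: "p dvd f" and \<beta>: "\<beta> \<in> Dp p"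
    and w: "\<And>c. \<rho> (\<zeta> \<gamma> ^ c) = w ^ c" and w': "\<And>c. \<rho>' (\<zeta> \<gamma> ^ c) = w' ^ c"
    and ww': "w * w' = 1" and wf: "w ^ f = 1"
  shows "Z_formula p \<zeta> \<rho> f \<gamma> \<beta> = Z_formula p \<zeta> \<rho>' f \<gamma> (\<beta> :: 'a)"
proof -
  let ?s = "1 - \<beta>"
  define F where "F c = angle_pow p c ?s * (\<Sum>j. (?s gchoose j) * (of_nat f / of_nat c) ^ j * of_rat (bernoulli j))" for c
  let ?S = "{c. 1 \<le> c \<and> c < f \<and> \<not> p dvd c}"
  have S: "f - c \<in> ?S" if "c \<in> ?S" for c
    using that f dvd_diffD1[of p f c] by auto
  have "(\<Sum>c\<in>?S. w ^ c * F c) = (\<Sum>c\<in>?S. w' ^ c * F c)"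
  proof (rule sum.reindex_bij_witness[of _ "\<lambda>c. f - c" "\<lambda>c. f - c"])
    fix c assume c: "c \<in> ?S"
    show "f - (f - c) = c" using c by simp
    show "f - c \<in> ?S" by (rule S[OF c])
    have "w ^ c * w' ^ c = 1" using ww' by (simp flip: power_mult_distrib)
    moreover have "w' ^ (f - c) * w' ^ c = 1"
    proof -
      have "w' ^ f = (w * w') ^ f" using wf by (simp add: power_mult_distrib)
      thus ?thesis using c ww' by (simp flip: power_add)
    qed
    ultimately have "w' ^ (f - c) = w ^ c"
      by (metis mult_right_cancel mult_zero_right zero_neq_one)
    moreover have "F (f - c) = F c"
      unfolding F_def using c by (intro angle_bernoulli_reflect f vabs_one_minus_Dp \<beta>) auto
    ultimately show "w' ^ (f - c) * F (f - c) = w ^ c * F c" by simp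
  next
    fix c assume c: "c \<in> ?S"
    show "f - (f - c) = c" using c by simp
    show "f - c \<in> ?S" by (rule S[OF c])
  qed
  \<comment> \<open>At \<open>\<beta> = 1\<close> both quotients are 0 by the convention for
    division by 0, so this point requires no separate case.\<close>
  hence "(\<Sum>c\<in>?S. w ^ c * F c) / (\<beta> - 1) = (\<Sum>c\<in>?S. w' ^ c * F c) / (\<beta> - 1)" by simp
  thus ?thesis
    by (simp add: Z_formula_def w w' F_def sum_divide_distrib mult.assoc)
qed

text \<open>The series stops at \<open>j = m\<close>, and \<open>\<langle>c\<rangle>^m = c^m\<close>
  combines with it to \<open>f^m B_m(c/f)\<close>.\<close>

lemma Z_formula_one_minus_nat:
  assumes f: "p dvd f" "f > 0" and k: "k > 0" and m: "m = k * (p - 1)"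
    and w: "\<And>c. \<rho> (\<zeta> \<gamma> ^ c) = w ^ c"
  shows "Z_formula p \<zeta> \<rho> f \<gamma> (1 - of_nat m :: 'a)
    = (char_bern m f w - of_nat p ^ m / of_nat p * char_bern m (f div p) (w ^ p)) / (- of_nat m)"
proof -
  let ?S = "{c. 1 \<le> c \<and> c < f \<and> \<not> p dvd c}"
  have f0: "(of_nat f :: 'a) \<noteq> 0" using f by simp
  have series: "angle_pow p c (of_nat m) * (\<Sum>j. (of_nat m gchoose j) * (of_nat f / of_nat c) ^ j * of_rat (bernoulli j))
      = of_nat f ^ m * bern_poly m (of_nat c / of_nat f :: 'a)" if c: "c \<in> ?S" for c
  proof -
    have c0: "(of_nat c :: 'a) \<noteq> 0" using c by (cases "c = 0") auto
    have "(\<Sum>j. (of_nat m gchoose j) * (of_nat f / of_nat c) ^ j * of_rat (bernoulli j) :: 'a)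
        = (\<Sum>j\<le>m. of_nat (m choose j) * (of_nat f / of_nat c) ^ j * of_rat (bernoulli j))"
      by (subst suminf_finite[of "{..m}"]) (simp_all flip: binomial_gbinomial add: binomial_eq_0)
    moreover have "angle_pow p c (of_nat m) = (of_nat c ^ m :: 'a)"
      unfolding m using c by (intro angle_pow_of_nat) simp
    moreover have term_eq: "of_nat c ^ m * (of_nat (m choose j) * (of_nat f / of_nat c) ^ j * of_rat (bernoulli j))
        = of_nat f ^ m * (of_nat (m choose j) * of_rat (bernoulli j) * (of_nat c / of_nat f :: 'a) ^ (m - j))"
      if "j \<le> m" for j
    proof -
      have "(of_nat c :: 'a) ^ m = of_nat c ^ j * of_nat c ^ (m - j)"
        "(of_nat f :: 'a) ^ m = of_nat f ^ j * of_nat f ^ (m - j)"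
        using that by (simp_all flip: power_add)
      thus ?thesis using c0 f0 by (simp add: power_divide)
    qed
    ultimately show ?thesis
      unfolding bern_poly_def by (simp only: sum_distrib_left) (intro sum.cong refl, simp only: term_eq atMost_iff)
  qed
  have "Z_formula p \<zeta> \<rho> f \<gamma> (1 - of_nat m)
      = (\<Sum>c\<in>?S. w ^ c * (angle_pow p c (of_nat m) *
          (\<Sum>j. (of_nat m gchoose j) * (of_nat f / of_nat c) ^ j * of_rat (bernoulli j)))) / of_nat f / (- of_nat m)"
    by (simp add: Z_formula_def w sum_divide_distrib mult.assoc sum_negf mult.commute[of "of_nat m" "of_nat f"])
  also have "(\<Sum>c\<in>?S. w ^ c * (angle_pow p c (of_nat m) *
          (\<Sum>j. (of_nat m gchoose j) * (of_nat f / of_nat c) ^ j * of_rat (bernoulli j))))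
      = of_nat f ^ m * (\<Sum>c\<in>?S. w ^ c * bern_poly m (of_nat c / of_nat f))"
    unfolding sum_distrib_left by (rule sum.cong[OF refl]) (simp only: series mult.left_commute)
  also have "of_nat f ^ m * (\<Sum>c\<in>?S. w ^ c * bern_poly m (of_nat c / of_nat f)) / of_nat f
      = char_bern m f w - of_nat p ^ m / of_nat p * char_bern m (f div p) (w ^ p)"
    using char_bern_coprime_part[of p f m w] f p_gt_2 by simp
  finally show ?thesis .
qed

text \<open>Replaces the modulus \<open>f\<close>, which varies with the class, by any
  \<open>N\<close> with \<open>w ^ N = 1\<close>; a common \<open>N\<close> is what Fourier
  inversion demands.\<close>

lemma Z_one_minus_nat:
  assumes f: "p dvd f" "f > 0" and k: "k > 0" and m: "m = k * (p - 1)"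
    and w: "\<And>c. \<rho> (\<zeta> \<gamma> ^ c) = w ^ c" and wf: "w ^ f = 1" and wN: "w ^ N = 1" "N > 0"
  shows "Z p \<zeta> \<rho> f \<gamma> (1 - of_nat m :: 'a)
    = Some ((char_bern m N w - of_nat p ^ m / of_nat p * char_bern m N (w ^ p)) / (- of_nat m))"
proof -
  have "m > 0" using k m p_gt_2 by simp
  hence "Z p \<zeta> \<rho> f \<gamma> (1 - of_nat m :: 'a) = Some (Z_formula p \<zeta> \<rho> f \<gamma> (1 - of_nat m))"
    by (simp add: Z_def)
  moreover have "char_bern m f w = char_bern m N w"
    by (rule char_bern_eq[OF wf f(2) wN])
  moreover have "char_bern m (f div p) (w ^ p) = char_bern m N (w ^ p)"
  proof (rule char_bern_eq)
    show "(w ^ p) ^ (f div p) = 1" using f wf by (simp flip: power_mult)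
    show "f div p > 0" using f by (auto elim!: dvdE intro!: Nat.gr0I)
    show "(w ^ p) ^ N = 1" using wN by (metis mult.commute power_mult power_one)
  qed (rule wN)
  moreover have "Z_formula p \<zeta> \<rho> f \<gamma> (1 - of_nat m)
      = (char_bern m f w - of_nat p ^ m / of_nat p * char_bern m (f div p) (w ^ p)) / (- of_nat m)"
    by (rule Z_formula_one_minus_nat[OF f k m]) (rule w)
  ultimately show ?thesis by simp
qed

end

lemma is_Cp_imp_padic_field:
  "padic_field TYPE('a::{field_char_0, complete_space}) p"
  if "is_Cp p TYPE('a)" "prime p" "p > 2"
  using that by unfold_locales (simp_all add: is_Cp_def)

theorem lemma7p14:
  fixes p :: nat
    and \<zeta> :: "rat \<Rightarrow> 'b::field_char_0"
    and \<rho> \<rho>' :: "'b \<Rightarrow> 'a::{field_char_0, complete_space}"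
    and \<theta> :: "rat \<Rightarrow> rat"
    and f :: "rat \<Rightarrow> nat"
  assumes "prime p" and "p > 2"
    and "is_Cp p TYPE('a)"
    and "is_zeta_system p \<zeta>"
    and "field_embedding_on (Qcyc p \<zeta>) \<rho>"
    and "\<theta> \<in> iso (QZ p) (QZ p)"
    and "is_twist p \<zeta> \<theta> \<rho> \<rho>'"
    and "\<And>\<gamma>. \<gamma> \<in> carrier (QZ p) \<Longrightarrow> f \<gamma> > 0 \<and> denom \<gamma> * p dvd f \<gamma>"
  shows
    "(is_pm_one p \<theta> \<longrightarrow>
        (\<forall>\<gamma>\<in>carrier (QZ p). \<forall>\<beta>\<in>Dp p. Z p \<zeta> \<rho> (f \<gamma>) \<gamma> \<beta> = Z p \<zeta> \<rho>' (f \<gamma>) \<gamma> \<beta>)) \<and>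
     (\<not> is_pm_one p \<theta> \<longrightarrow>
        (\<forall>k m \<beta>. k > 0 \<and> m = k * (p - 1) \<and> \<beta> = 1 - of_nat m \<longrightarrow>
           (\<lambda>\<gamma>\<in>carrier (QZ p). Z p \<zeta> \<rho> (f \<gamma>) \<gamma> \<beta>) \<noteq> (\<lambda>\<gamma>\<in>carrier (QZ p). Z p \<zeta> \<rho>' (f \<gamma>) \<gamma> \<beta>)))"
proof -
  interpret padic_field "TYPE('a)" p
    using assms(1-3) by (intro is_Cp_imp_padic_field)
  note zeta = assms(4)
  let ?G = "carrier (QZ p)"
  have hom: "\<theta> \<in> hom (QZ p) (QZ p)" and bij: "bij_betw \<theta> ?G ?G"
    using assms(6) by (simp_all add: iso_def)
  have \<theta>_in: "\<theta> \<gamma> \<in> ?G" if "\<gamma> \<in> ?G" for \<gamma>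
    using hom that by (auto simp: hom_def)
  have \<rho>'_emb: "field_embedding_on (Qcyc p \<zeta>) \<rho>'" and \<rho>'_eq: "\<rho>' (\<zeta> \<gamma>) = \<rho> (\<zeta> (\<theta> \<gamma>))" if "\<gamma> \<in> ?G" for \<gamma>
    using assms(7) that by (simp_all add: is_twist_def)
  have \<rho>_pow: "\<rho> (\<zeta> \<gamma> ^ c) = \<rho> (\<zeta> \<gamma>) ^ c" if "\<gamma> \<in> ?G" for \<gamma> c
    by (rule field_embedding_on_power[OF assms(5) is_subfield_Qcyc zeta_in_Qcyc[OF that]])
  have \<rho>'_pow: "\<rho>' (\<zeta> \<gamma> ^ c) = \<rho> (\<zeta> (\<theta> \<gamma>)) ^ c" if "\<gamma> \<in> ?G" for \<gamma> c
    using field_embedding_on_power[OF \<rho>'_emb is_subfield_Qcyc zeta_in_Qcyc, OF that that] that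
    by (simp add: \<rho>'_eq)
  have order: "\<rho> (\<zeta> \<gamma>) ^ n = 1 \<longleftrightarrow> denom \<gamma> dvd n" if "\<gamma> \<in> ?G" for \<gamma> n
    using field_embedding_on_eq_1_iff[OF assms(5) is_subfield_Qcyc subfield_power[OF is_subfield_Qcyc zeta_in_Qcyc[OF that]], of n]
      zeta that by (simp add: \<rho>_pow is_zeta_system_def)
  have f: "p dvd f \<gamma>" "f \<gamma> > 0" "denom \<gamma> dvd f \<gamma>" if "\<gamma> \<in> ?G" for \<gamma>
    using assms(8)[OF that] dvd_mult_right dvd_mult_left by blast+
  have \<rho>_f: "\<rho> (\<zeta> \<gamma>) ^ f \<gamma> = 1" if "\<gamma> \<in> ?G" for \<gamma>
    using f that by (simp add: order)
  have zeta_0: "\<zeta> 0 = 1"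
    using zeta_frac_of_nat_mult[OF zeta zero_in_QZ, of 0] by simp
  have \<rho>_1: "\<rho> 1 = 1" using assms(5) by (simp add: field_embedding_on_def)

  have part1: "Z p \<zeta> \<rho> (f \<gamma>) \<gamma> \<beta> = Z p \<zeta> \<rho>' (f \<gamma>) \<gamma> \<beta>"
    if pm: "is_pm_one p \<theta>" and \<gamma>: "\<gamma> \<in> ?G" and \<beta>: "\<beta> \<in> Dp p" for \<gamma> \<beta>
  proof (rule Z_eqI[OF _ \<beta>])
    fix \<beta> :: 'a assume \<beta>: "\<beta> \<in> Dp p"
    from pm \<gamma> consider "\<theta> \<gamma> = \<gamma>" | "\<theta> \<gamma> = frac (- \<gamma>)"
      unfolding is_pm_one_def by (metis inv_QZ)
    thus "Z_formula p \<zeta> \<rho> (f \<gamma>) \<gamma> \<beta> = Z_formula p \<zeta> \<rho>' (f \<gamma>) \<gamma> \<beta>"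
    proof cases
      case 1
      thus ?thesis by (simp add: Z_formula_def \<rho>_pow[OF \<gamma>] \<rho>'_pow[OF \<gamma>])
    next
      case 2
      \<comment> \<open>Negation modulo 1 becomes inversion of the root of unity, the situation of
        \<open>Z_formula_reflect\<close>.\<close>
      have "\<zeta> \<gamma> * \<zeta> (\<theta> \<gamma>) = \<zeta> (\<gamma> \<otimes>\<^bsub>QZ p\<^esub> \<theta> \<gamma>)"
        using zeta \<gamma> \<theta>_in[OF \<gamma>] by (simp only: is_zeta_system_def)
      hence "\<zeta> \<gamma> * \<zeta> (\<theta> \<gamma>) = 1" by (simp add: 2 zeta_0)
      moreover have "\<rho> (\<zeta> \<gamma> * \<zeta> (\<theta> \<gamma>)) = \<rho> (\<zeta> \<gamma>) * \<rho> (\<zeta> (\<theta> \<gamma>))"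
        using assms(5) zeta_in_Qcyc \<gamma> \<theta>_in[OF \<gamma>] by (metis field_embedding_on_def)
      ultimately have "\<rho> (\<zeta> \<gamma>) * \<rho> (\<zeta> (\<theta> \<gamma>)) = 1" by (simp add: \<rho>_1)
      thus ?thesis
        using f(1)[OF \<gamma>] \<beta> \<rho>_pow[OF \<gamma>] \<rho>'_pow[OF \<gamma>] \<rho>_f[OF \<gamma>] by (intro Z_formula_reflect) auto
    qed
  qed

  \<comment> \<open>The second claim in contraposition. For each \<open>N\<close> the functionals
    are tested at the multiples of \<open>1/N\<close>, which determine \<open>\<theta> (1/N)\<close>
    up to sign.\<close>
  have part2: "is_pm_one p \<theta>"
    if k: "k > 0" and m: "m = k * (p - 1)"
      and eq: "(\<lambda>\<gamma>\<in>?G. Z p \<zeta> \<rho> (f \<gamma>) \<gamma> (1 - of_nat m)) = (\<lambda>\<gamma>\<in>?G. Z p \<zeta> \<rho>' (f \<gamma>) \<gamma> (1 - of_nat m))" for k m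
  proof (rule is_pm_oneI[OF hom])
    fix N :: nat assume N: "N > 1" and co: "coprime N p"
    define g where "g = (1 / of_nat N :: rat)"
    have g: "g \<in> ?G" unfolding g_def by (rule one_div_in_QZ[OF N co])
    have denom_g: "denom g dvd n \<longleftrightarrow> N dvd n" for n
    proof -
      have "denom g = N"
      proof (rule dvd_antisym)
        show "denom g dvd N" using N by (simp add: denom_dvd_iff g_def)
        obtain t where t: "of_nat (denom g) * g = of_int t"
          using denom_mult_Ints[of g] by (auto elim: Ints_cases)
        hence "of_int (int (denom g)) = (of_int (t * int N) :: rat)" using N by (simp add: g_def field_simps)
        hence "int (denom g) = t * int N" by (simp only: of_int_eq_iff)
        thus "N dvd denom g" by (metis dvd_triv_right int_dvd_int_iff)
      qed
      thus ?thesis by simp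
    qed
    define z where "z = \<rho> (\<zeta> g)"
    define v where "v = \<rho> (\<zeta> (\<theta> g))"
    have z_ord: "z ^ n = 1 \<longleftrightarrow> N dvd n" for n
      by (simp add: z_def order[OF g] denom_g)
    have z_pow: "\<rho> (\<zeta> (frac (of_nat i * g))) = z ^ i" for i
      by (simp add: zeta_frac_of_nat_mult[OF zeta g] \<rho>_pow[OF g] z_def)
    have v_pow: "\<rho> (\<zeta> (\<theta> (frac (of_nat i * g)))) = v ^ i" for i
      by (simp add: QZ_hom_of_nat_mult[OF hom g] zeta_frac_of_nat_mult[OF zeta \<theta>_in[OF g]] \<rho>_pow[OF \<theta>_in[OF g]] v_def)
    \<comment> \<open>Injectivity of \<open>\<theta>\<close> gives \<open>v\<close> the exact order
      \<open>N\<close>, so that Fourier inversion may be carried out with \<open>v\<close> as well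
      as with \<open>z\<close>.\<close>
    have v_ord: "v ^ n = 1 \<longleftrightarrow> N dvd n" for n
    proof -
      have "\<theta> 0 = 0" using hom_one[OF hom group_QZ group_QZ] by simp
      let ?x = "frac (of_nat n * g)"
      have x: "?x \<in> ?G" by (rule frac_of_nat_mult_in_QZ[OF g])
      have "v ^ n = 1 \<longleftrightarrow> denom (\<theta> ?x) dvd 1"
        using order[OF \<theta>_in[OF x], of 1] by (simp add: v_pow)
      also have "\<dots> \<longleftrightarrow> \<theta> ?x \<in> \<int>"
        using denom_dvd_iff[of "\<theta> ?x" 1] by simp
      also have "\<dots> \<longleftrightarrow> \<theta> ?x = 0"
        using frac_QZ[OF \<theta>_in[OF x]] by (metis frac_eq_0_iff)
      also have "\<dots> \<longleftrightarrow> ?x = 0"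
        using bij_betw_imp_inj_on[OF bij] x zero_in_QZ \<open>\<theta> 0 = 0\<close> by (metis inj_onD)
      also have "\<dots> \<longleftrightarrow> denom g dvd n" by (simp add: denom_dvd_iff)
      finally show ?thesis by (simp add: denom_g)
    qed
    have "denom (\<theta> g) dvd N"
      using v_ord[of N] order[OF \<theta>_in[OF g], of N] by (simp add: v_def)
    then obtain a where a: "a < N" "\<theta> g = of_nat a / of_nat N"
      using QZ_eq_of_nat_div[OF \<theta>_in[OF g]] N by (metis gr_implies_not0 not_gr_zero)
    have v_z: "v = z ^ a"
      using z_pow[of a] frac_of_nat_div[OF a(1)] by (simp add: v_def a(2)) (simp add: g_def)
    have "a = 1 \<or> a = N - 1"
    proof (rule char_bern_order_eq[OF z_ord v_ord v_z a(1) N])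
      show "coprime p N" using co by (simp add: coprime_commute)
      show "p > 1" using p_gt_2 by simp
      show "even m" using odd_p by (simp add: m)
      show "m > 0" using k p_gt_2 by (simp add: m)
      fix i
      let ?x = "frac (of_nat i * g)"
      have x: "?x \<in> ?G" by (rule frac_of_nat_mult_in_QZ[OF g])
      have roots: "(z ^ i) ^ N = 1" "(v ^ i) ^ N = 1"
        by (simp_all add: z_ord v_ord flip: power_mult)
      have pows: "\<rho> (\<zeta> ?x ^ c) = (z ^ i) ^ c" "\<rho>' (\<zeta> ?x ^ c) = (v ^ i) ^ c" for c
        by (simp_all only: \<rho>_pow[OF x] \<rho>'_pow[OF x] z_pow v_pow)
      have zf: "(z ^ i) ^ f ?x = 1" using \<rho>_f[OF x] by (simp only: z_pow)
      have "\<zeta> ?x ^ f ?x = 1"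
        using zeta x f(3)[OF x] unfolding is_zeta_system_def by blast
      hence "\<rho>' (\<zeta> ?x ^ f ?x) = 1"
        using \<rho>'_emb[OF x] by (simp only: field_embedding_on_def)
      hence vf: "(v ^ i) ^ f ?x = 1" by (simp only: pows)
      \<comment> \<open>The assumed equality at the class of \<open>i/N\<close>, where the two roots
        of unity are \<open>z ^ i\<close> and \<open>v ^ i\<close>.\<close>
      have "Z p \<zeta> \<rho> (f ?x) ?x (1 - of_nat m) = Z p \<zeta> \<rho>' (f ?x) ?x (1 - of_nat m)"
        using fun_cong[OF eq, of ?x] x by simp
      hence "(char_bern m N (z ^ i) - of_nat p ^ m / of_nat p * char_bern m N ((z ^ i) ^ p)) / (- of_nat m)
          = (char_bern m N (v ^ i) - of_nat p ^ m / of_nat p * char_bern m N ((v ^ i) ^ p)) / (- of_nat m)"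
        using Z_one_minus_nat[of "f ?x" k m \<rho> \<zeta> ?x "z ^ i" N, OF f(1,2)[OF x] k m pows(1) zf roots(1)]
          Z_one_minus_nat[of "f ?x" k m \<rho>' \<zeta> ?x "v ^ i" N, OF f(1,2)[OF x] k m pows(2) vf roots(2)] N by simp
      thus "char_bern m N (z ^ i) - of_nat p ^ m / of_nat p * char_bern m N ((z ^ i) ^ p)
          = char_bern m N (v ^ i) - of_nat p ^ m / of_nat p * char_bern m N ((v ^ i) ^ p)"
        using \<open>m > 0\<close> by simp
    qed
    thus "\<theta> (1 / of_nat N) \<in> {1 / of_nat N, 1 - 1 / of_nat N}"
      using a(2) N by (auto simp: g_def of_nat_diff field_simps)
  qed

  show ?thesis using part1 part2 by blast
qed

end
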